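(* Let $P(x,y)$ be an $\mathbb{R}$-isotropic binary form of degree $n\geq 3$ with non-zero discriminant. Then there exists a real number $M_P>0$ such that $\mathrm{Spec}(P)=[0,M_P]$.
   Context: A binary form of degree $n$ is a homogeneous polynomial $P(x,y)=\sum_{i=0}^n c_i x^i y^{n-i}$ with real coefficients $c_i$. It is called $\mathbb{R}$-anisotropic if the only real solution of $P(x,y)=0$ is $x=y=0$, and $\mathbb{R}$-isotropic otherwise. A lattice $\Lambda\subset\mathbb{R}^2$ is unimodular if it has covolume $1$. For a binary form $P$, $$\mathrm{Spec}(P):=\left\{\inf_{v\in\Lambda\setminus\{0\}}|P(v)| : \Lambda\subset\mathbb{R}^2 \text{ a unimodular lattice}\right\}.$$ *)

theory Defs
  imports Complex_Main "HOL-Analysis.Product_Vector" "Subresultants.Resultant_Prelim"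
begin

section \<open>Binary forms\<close>

definition binary_form :: "nat \<Rightarrow> (nat \<Rightarrow> real) \<Rightarrow> real \<times> real \<Rightarrow> real" where
  "binary_form n c = (\<lambda>(x, y). \<Sum>i\<le>n. c i * x ^ i * y ^ (n - i))"

definition anisotropic :: "(real \<times> real \<Rightarrow> real) \<Rightarrow> bool" where
  "anisotropic P \<longleftrightarrow> {v. P v = 0} = {0}"

definition isotropic :: "(real \<times> real \<Rightarrow> real) \<Rightarrow> bool" where
  "isotropic P \<longleftrightarrow> \<not> anisotropic P"

text \<open>The discriminant of a binary form \<open>P\<close> of degree \<open>n \<ge> 2\<close> is
  \<open>(-1)^(n(n-1)/2) Res(P_x, P_y) / n^(n-2)\<close>, where \<open>Res\<close> is the resultant of two binary forms
  of degree \<open>n - 1\<close>.  The partial derivatives are represented by their dehomogenisations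
  at \<open>y = 1\<close>, and the Sylvester matrix is taken in the formal degrees \<open>(n - 1, n - 1)\<close>, so that
  roots at infinity (vanishing leading coefficients) are accounted for.\<close>

definition partial_x :: "nat \<Rightarrow> (nat \<Rightarrow> real) \<Rightarrow> real poly" where
  "partial_x n c = (\<Sum>i<n. monom (real (Suc i) * c (Suc i)) i)"

definition partial_y :: "nat \<Rightarrow> (nat \<Rightarrow> real) \<Rightarrow> real poly" where
  "partial_y n c = (\<Sum>i<n. monom (real (n - i) * c i) i)"

definition form_discriminant :: "nat \<Rightarrow> (nat \<Rightarrow> real) \<Rightarrow> real" where
  "form_discriminant n c =
     (-1) ^ (n * (n - 1) div 2) * resultant_sub (n - 1) (n - 1) (partial_x n c) (partial_y n c)
       / real n ^ (n - 2)"

section \<open>Lattices in the plane\<close>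

definition det2 :: "real \<times> real \<Rightarrow> real \<times> real \<Rightarrow> real" where
  "det2 u w = fst u * snd w - snd u * fst w"

text \<open>The condition \<open>det2 u w \<noteq> 0\<close> says that \<open>u\<close> and \<open>w\<close> are linearly independent over the reals.\<close>

definition lattice_basis :: "real \<times> real \<Rightarrow> real \<times> real \<Rightarrow> (real \<times> real) set \<Rightarrow> bool" where
  "lattice_basis u w L \<longleftrightarrow>
     det2 u w \<noteq> 0 \<and> L = {of_int a *\<^sub>R u + of_int b *\<^sub>R w | a b :: int. True}"

definition is_lattice :: "(real \<times> real) set \<Rightarrow> bool" where
  "is_lattice L \<longleftrightarrow> (\<exists>u w. lattice_basis u w L)"

text \<open>The covolume is the area of the fundamental parallelogram spanned by any basis;
  see \<open>covolume_eq\<close> for the independence of the basis.\<close>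

definition covolume :: "(real \<times> real) set \<Rightarrow> real" where
  "covolume L = (THE d. \<exists>u w. lattice_basis u w L \<and> d = \<bar>det2 u w\<bar>)"

definition unimodular_lattice :: "(real \<times> real) set \<Rightarrow> bool" where
  "unimodular_lattice L \<longleftrightarrow> is_lattice L \<and> covolume L = 1"

definition Spec :: "(real \<times> real \<Rightarrow> real) \<Rightarrow> real set" where
  "Spec P = {(INF v \<in> L - {0}. \<bar>P v\<bar>) | L. unimodular_lattice L}"

lemma det2_int_comb:
  "det2 (a *\<^sub>R u + b *\<^sub>R w) (c *\<^sub>R u + d *\<^sub>R w) = (a * d - b * c) * det2 u w"
  by (simp add: det2_def algebra_simps)

lemma lattice_basis_le:
  assumes "lattice_basis u w L" "lattice_basis u' w' L"
  shows "\<bar>det2 u w\<bar> \<le> \<bar>det2 u' w'\<bar>"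
proof -
  have "u' = of_int 1 *\<^sub>R u' + of_int 0 *\<^sub>R w'" "w' = of_int 0 *\<^sub>R u' + of_int 1 *\<^sub>R w'"
    by simp_all
  then have "u' \<in> L" "w' \<in> L"
    using assms(2) unfolding lattice_basis_def by blast+
  then obtain a b c d :: int
    where "u' = of_int a *\<^sub>R u + of_int b *\<^sub>R w" "w' = of_int c *\<^sub>R u + of_int d *\<^sub>R w"
    using assms(1) unfolding lattice_basis_def by blast
  then have eq: "det2 u' w' = of_int (a * d - b * c) * det2 u w"
    by (simp only: det2_int_comb) simp
  moreover have "det2 u' w' \<noteq> 0" using assms(2) by (simp add: lattice_basis_def)
  ultimately have "real_of_int (a * d - b * c) \<noteq> 0" by (metis mult_zero_left)
  then have "a * d - b * c \<noteq> 0" using of_int_0 by metis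
  then have "1 \<le> \<bar>a * d - b * c\<bar>" by linarith
  then have "(1::real) \<le> \<bar>of_int (a * d - b * c)\<bar>" by linarith
  then show ?thesis unfolding eq abs_mult
    using mult_right_mono[of 1 _ "\<bar>det2 u w\<bar>"] by fastforce
qed

lemma covolume_eq:
  assumes "lattice_basis u w L"
  shows "covolume L = \<bar>det2 u w\<bar>"
  unfolding covolume_def using assms lattice_basis_le by (blast intro: the_equality antisym)

end

theory Submission
  imports Defs "HOL-Analysis.Analysis" "HOL-Real_Asymp.Real_Asymp"
begin

text \<open>
  Write \<open>m(L)\<close> for the infimum of \<open>|P|\<close> over the non-zero vectors of a lattice \<open>L\<close>.
  A lattice through an isotropic vector has \<open>m(L) = 0\<close>.  By reduction theory the unimodular
  lattices with \<open>m(L) \<ge> t > 0\<close> have bases in a fixed compact set, and \<open>m\<close> is upper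
  semicontinuous, so \<open>m\<close> attains its maximum \<open>M\<close> as soon as it is not identically zero.  The
  substance is that \<open>M > 0\<close> and that every \<open>t\<close> between \<open>0\<close> and \<open>M\<close> is a value, although
  \<open>m\<close> is not continuous.

  Rotate a maximal lattice \<open>L\<close> until it contains an isotropic vector, and let \<open>s\<close> be the
  last angle before that with \<open>m(rot s L) \<ge> t\<close>.  The theorem follows from the claim
  (\<open>exists_avoiding_after\<close>): if \<open>m(rot s L) > t\<close>, then there are angles \<open>s' > s\<close> arbitrarily
  close to \<open>s\<close> with \<open>m(rot s' L) \<ge> t\<close>.  In polar coordinates a vector \<open>(r, \<phi>)\<close> is bad at
  the angle \<open>s'\<close> if \<open>r ^ n * |p (\<phi> + s')| < t\<close>, where \<open>p\<close> is \<open>P\<close> on the unit circle.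
  The discriminant being non-zero, the zeros of \<open>p\<close> are simple, so the bad angles of a vector
  lie in short intervals, one for each isotropic direction, of length about \<open>t / r ^ n\<close>.

  Two facts make the claim work.  First, two non-parallel vectors of a unimodular lattice have
  determinant at least \<open>1\<close>, so if both are of length at most \<open>R\<close> and bad, for the same
  isotropic direction, inside an interval of length much smaller than \<open>1 / R\<^sup>2\<close>, then
  one of the two is shorter than \<open>R\<close> by a power of \<open>R\<close> (\<open>hits_collinear\<close>).  As \<open>n \<ge> 3\<close>,
  the bad intervals are much shorter than \<open>1 / r\<^sup>2\<close>, and a nested interval construction
  avoids them all, removing at each scale at most one interval per isotropic direction
  (\<open>exists_avoiding\<close>); started at a scale below the shortest vector of the integer lattice, this
  gives \<open>M > 0\<close>.  Secondly, to start the construction next to \<open>s\<close>, the bad intervals near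
  \<open>s\<close> have length at most a constant times their distance from \<open>s\<close>, because \<open>|P|\<close> exceeds
  \<open>t\<close> by a fixed amount at \<open>s\<close> itself.  A bounded number of such intervals cannot cover
  \<open>(s, s + \<rho>)\<close>, and in fact leaves a gap of length proportional to \<open>\<rho>\<close>
  (\<open>avoid_sparse_sets\<close>).
\<close>

section \<open>Intervals that avoid finitely many sets\<close>

text \<open>A set of diameter below a third of an interval misses its first or its last third;
  iterating this deals with the sets one at a time.\<close>
lemma avoid_short_sets:
  fixes S :: "'i \<Rightarrow> real set"
  assumes "finite I"
    and "\<And>i x y. i \<in> I \<Longrightarrow> x \<in> S i \<Longrightarrow> y \<in> S i \<Longrightarrow> \<bar>x - y\<bar> < d"
    and "3 ^ card I * d \<le> l" and "0 < l"
  shows "\<exists>b\<ge>a. b + l / 3 ^ card I \<le> a + l \<and> (\<forall>i\<in>I. {b..b + l / 3 ^ card I} \<inter> S i = {})"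
  using assms
proof (induction I arbitrary: a l rule: finite_induct)
  case empty
  then show ?case by auto
next
  case (insert i I)
  have cd: "card (insert i I) = Suc (card I)" using insert by simp
  have d1: "3 ^ card I * d \<le> l / 3" using insert.prems(2) cd by simp
  have d2: "d \<le> l / 3"
  proof (cases "d \<le> 0")
    case False
    then have "1 * d \<le> 3 ^ card I * d" by (intro mult_right_mono) auto
    then show ?thesis using d1 by linarith
  qed (use insert.prems(3) in linarith)
  have "\<exists>a'\<ge>a. a' + l / 3 \<le> a + l \<and> {a'..a' + l / 3} \<inter> S i = {}"
  proof (cases "{a..a + l / 3} \<inter> S i = {}")
    case True
    then show ?thesis using insert.prems(3) by (intro exI[of _ a]) auto
  next
    case False
    then obtain x where x: "x \<in> S i" "x \<le> a + l / 3" by auto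
    have "{a + 2 * l / 3..a + 2 * l / 3 + l / 3} \<inter> S i = {}"
    proof (rule ccontr)
      assume "\<not> ?thesis"
      then obtain y where "y \<in> S i" "y \<ge> a + 2 * l / 3" by auto
      then show False using insert.prems(1)[of i x y] x d2 by auto
    qed
    then show ?thesis using insert.prems(3) by (intro exI[of _ "a + 2 * l / 3"]) auto
  qed
  then obtain a' where a': "a' \<ge> a" "a' + l / 3 \<le> a + l" "{a'..a' + l / 3} \<inter> S i = {}" by blast
  obtain b where b: "b \<ge> a'" "b + (l / 3) / 3 ^ card I \<le> a' + l / 3"
      "\<forall>j\<in>I. {b..b + (l / 3) / 3 ^ card I} \<inter> S j = {}"
    using insert.IH[of "l / 3" a'] insert.prems d1 by auto
  have e: "(l / 3) / 3 ^ card I = l / 3 ^ card (insert i I)" using cd by simp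
  have "{b..b + l / 3 ^ card (insert i I)} \<subseteq> {a'..a' + l / 3}" using b e by auto
  then have "{b..b + l / 3 ^ card (insert i I)} \<inter> S i = {}" using a'(3) by blast
  then show ?case using a'(1,2) b unfolding e by (intro exI[of _ b]) simp
qed

text \<open>The hypothesis says that each set lies to the right of \<open>s\<close> and has diameter at most \<open>A\<close>
  times its distance from \<open>s\<close>.  The proportion \<open>\<kappa>\<close> depends only on \<open>A\<close> and the index set,
  not on the sets or the scale \<open>\<rho>\<close>.\<close>
lemma avoid_sparse_sets:
  fixes A s :: real and I :: "'i set"
  assumes "finite I" and "A \<ge> 0"
  shows "\<exists>\<kappa>>0. \<kappa> \<le> 1 \<and> (\<forall>S \<rho>. 0 < \<rho> \<longrightarrow>
           (\<forall>i\<in>I. \<forall>x\<in>S i. \<forall>y\<in>S i. y - x \<le> A * (x - s)) \<longrightarrow>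
           (\<exists>a>s. a + \<kappa> * \<rho> \<le> s + \<rho> \<and> (\<forall>i\<in>I. {a..a + \<kappa> * \<rho>} \<inter> S i = {})))"
  using assms(1)
proof (induction I rule: finite_induct)
  case empty
  have "\<exists>a>s. a + 1 / 2 * \<rho> \<le> s + \<rho>" if "0 < \<rho>" for \<rho> :: real
    using that by (intro exI[of _ "s + \<rho> / 2"]) auto
  then show ?case by (intro exI[of _ "1 / 2"]) simp
next
  case (insert i I)
  then obtain \<kappa> where \<kappa>: "\<kappa> > 0" "\<kappa> \<le> 1" and IH: "\<And>S \<rho>. 0 < \<rho> \<Longrightarrow>
           (\<forall>i\<in>I. \<forall>x\<in>S i. \<forall>y\<in>S i. y - x \<le> A * (x - s)) \<Longrightarrow>
           (\<exists>a>s. a + \<kappa> * \<rho> \<le> s + \<rho> \<and> (\<forall>i\<in>I. {a..a + \<kappa> * \<rho>} \<inter> S i = {}))"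
    by blast
  define \<eta> where "\<eta> = \<kappa> / (4 * (1 + A))"
  have "1 + A \<noteq> 0" using assms(2) by simp
  then have \<eta>: "\<eta> > 0" "(1 + A) * \<eta> = \<kappa> / 4"
    using \<kappa> assms(2) by (simp_all add: \<eta>_def) (simp add: divide_simps)
  have \<eta>1: "\<eta> \<le> 1 / 4"
  proof -
    have "0 \<le> A * \<eta>" using \<eta> assms(2) by simp
    then show ?thesis using \<eta>(2) \<kappa>(2) by (simp add: distrib_right)
  qed
  have k1: "\<kappa> * \<eta> \<le> \<kappa> * (1 / 4)" using \<kappa> \<eta>1 by (intro mult_left_mono) auto
  show ?case
  proof (rule exI[of _ "\<kappa> * \<eta>"], intro conjI allI impI)
    show "0 < \<kappa> * \<eta>" using \<kappa> \<eta> by simp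
    show "\<kappa> * \<eta> \<le> 1" using k1 \<kappa> by linarith
    fix S and \<rho> :: real
    assume \<rho>: "0 < \<rho>" and S: "\<forall>i\<in>insert i I. \<forall>x\<in>S i. \<forall>y\<in>S i. y - x \<le> A * (x - s)"
    have k2: "\<kappa> * \<eta> * \<rho> \<le> \<kappa> * \<rho> / 4" using mult_right_mono[OF k1, of \<rho>] \<rho> by simp
    show "\<exists>a>s. a + \<kappa> * \<eta> * \<rho> \<le> s + \<rho> \<and> (\<forall>i\<in>insert i I. {a..a + \<kappa> * \<eta> * \<rho>} \<inter> S i = {})"
    \<comment> \<open>A set that comes within \<open>\<eta> * \<rho>\<close> of \<open>s\<close> stays to the left of the right half of the
        interval for the other sets; otherwise the scale is reduced to \<open>\<eta> * \<rho>\<close>.\<close>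
    proof (cases "\<exists>x\<in>S i. x - s \<le> \<eta> * \<rho>")
      case True
      then obtain x where x: "x \<in> S i" "x - s \<le> \<eta> * \<rho>" by blast
      obtain a where a: "a > s" "a + \<kappa> * \<rho> \<le> s + \<rho>" "\<forall>i\<in>I. {a..a + \<kappa> * \<rho>} \<inter> S i = {}"
        using IH[of \<rho> S] \<rho> S by auto
      have y: "y \<le> s + \<kappa> * \<rho> / 4" if "y \<in> S i" for y
      proof -
        have "y - x \<le> A * (x - s)" using S x that by auto
        also have "\<dots> \<le> A * (\<eta> * \<rho>)" using x assms(2) by (intro mult_left_mono) auto
        finally have "y - s \<le> (1 + A) * \<eta> * \<rho>" using x by (simp add: algebra_simps)
        then show ?thesis using \<eta>(2) by simp
      qed
      let ?a = "a + \<kappa> * \<rho> / 2"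
      have pos: "0 < \<kappa> * \<rho>" using \<kappa> \<rho> by simp
      have sub: "{?a..?a + \<kappa> * \<eta> * \<rho>} \<subseteq> {a..a + \<kappa> * \<rho>}" using k2 pos by auto
      have "{?a..?a + \<kappa> * \<eta> * \<rho>} \<inter> S i = {}" using y pos a(1) by force
      moreover have "\<forall>j\<in>I. {?a..?a + \<kappa> * \<eta> * \<rho>} \<inter> S j = {}" using a(3) sub by blast
      ultimately show ?thesis using a(1,2) k2 pos by (intro exI[of _ ?a]) auto
    next
      case False
      obtain a where a: "a > s" "a + \<kappa> * (\<eta> * \<rho>) \<le> s + \<eta> * \<rho>"
          "\<forall>i\<in>I. {a..a + \<kappa> * (\<eta> * \<rho>)} \<inter> S i = {}"
        using IH[of "\<eta> * \<rho>" S] \<rho> S \<eta> by auto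
      have "{a..a + \<kappa> * (\<eta> * \<rho>)} \<inter> S i = {}" using False a(2) by force
      moreover have "\<eta> * \<rho> \<le> \<rho>" using \<eta>1 \<rho> by simp
      ultimately show ?thesis using a by (intro exI[of _ a]) (auto simp: mult.assoc)
    qed
  qed
qed

lemma abs_le_twice_sin:
  fixes x :: real
  assumes "\<bar>x\<bar> \<le> 1"
  shows "\<bar>x\<bar> \<le> 2 * \<bar>sin x\<bar>"
proof -
  have *: "y \<le> 2 * sin y" if "0 \<le> y" "y \<le> 1" for y :: real
  proof (cases "y = 0")
    case False
    have "\<exists>z. 0 < z \<and> z < y \<and> sin y - sin 0 = (y - 0) * cos z"
      using that False by (intro MVT2) (auto intro!: derivative_eq_intros)
    then obtain z where z: "0 < z" "z < y" "sin y = y * cos z" by auto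
    have "cos z \<ge> cos (pi / 3)"
      using z that pi_gt3 by (intro cos_monotone_0_pi_le) auto
    then have "y * (1 / 2) \<le> y * cos z" using that by (intro mult_left_mono) (auto simp: cos_60)
    then show ?thesis using z by simp
  qed simp
  show ?thesis
    using *[of x] *[of "-x"] assms by (cases "x \<ge> 0") (auto simp: abs_if)
qed

lemma abs_sin_diff_le: "\<bar>sin (x - y)\<bar> \<le> \<bar>sin x\<bar> + \<bar>sin (y::real)\<bar>"
proof -
  have "\<bar>sin (x - y)\<bar> \<le> \<bar>sin x * cos y\<bar> + \<bar>cos x * sin y\<bar>"
    unfolding sin_diff by (rule abs_triangle_ineq4)
  also have "\<dots> \<le> \<bar>sin x\<bar> + \<bar>sin y\<bar>"
    unfolding abs_mult by (intro add_mono mult_right_le_one_le mult_left_le_one_le) auto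
  finally show ?thesis .
qed

lemma abs_sin_add_of_sin_eq_0: "sin d = 0 \<Longrightarrow> \<bar>sin (x + d)\<bar> = \<bar>sin (x::real)\<bar>"
proof -
  assume "sin d = 0"
  then have "\<bar>cos d\<bar> = 1" using sin_zero_abs_cos_one by blast
  then show ?thesis using \<open>sin d = 0\<close> by (simp add: sin_add abs_mult)
qed

section \<open>Avoiding the bad angles\<close>

text \<open>The properties used of the restriction of a binary form of degree \<open>n\<close> to the unit circle,
  as a function of the angle.  The assumption \<open>near\<close> encodes simple zeros: \<open>\<Theta>\<close> contains the
  directions of the zeros, up to multiples of \<open>\<pi>\<close>, and \<open>|p|\<close> is at least proportional to the
  distance from them.  It is harmless if \<open>\<Theta>\<close> contains further points.\<close>
locale circle_function =
  fixes n :: nat and p :: "real \<Rightarrow> real" and \<Theta> :: "real set" and C B :: real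
  assumes n: "3 \<le> n"
    and fin: "finite \<Theta>"
    and C: "0 < C" and B: "0 < B"
    and near: "\<And>x. \<exists>\<tau>\<in>\<Theta>. \<bar>sin (x - \<tau>)\<bar> \<le> C * \<bar>p x\<bar>"
    and shift: "\<And>x d. sin d = 0 \<Longrightarrow> \<bar>p (x + d)\<bar> = \<bar>p x\<bar>"
    and lipschitz: "\<And>x y. \<bar>p x - p y\<bar> \<le> B * \<bar>x - y\<bar>"

text \<open>A set of pairs \<open>(r, \<phi>)\<close>, read as polar coordinates, is separated if any two of its vectors
  are parallel or span a parallelogram of area at least \<open>1\<close>.\<close>
definition separated :: "(real \<times> real) set \<Rightarrow> bool" where
  "separated W \<longleftrightarrow> (\<forall>(r, \<phi>)\<in>W. 0 < r) \<and>
     (\<forall>(r, \<phi>)\<in>W. \<forall>(r', \<phi>')\<in>W. sin (\<phi> - \<phi>') = 0 \<or> 1 \<le> r * r' * \<bar>sin (\<phi> - \<phi>')\<bar>)"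

lemma separated_pos: "separated W \<Longrightarrow> (r, \<phi>) \<in> W \<Longrightarrow> 0 < r"
  unfolding separated_def by blast

lemma separatedD:
  "separated W \<Longrightarrow> (r, \<phi>) \<in> W \<Longrightarrow> (r', \<phi>') \<in> W \<Longrightarrow> sin (\<phi> - \<phi>') \<noteq> 0 \<Longrightarrow>
     1 \<le> r * r' * \<bar>sin (\<phi> - \<phi>')\<bar>"
  unfolding separated_def by blast

context circle_function
begin

text \<open>The angles \<open>s\<close> for which the rotated vector \<open>v = (r, \<phi>)\<close> has form value below \<open>t\<close> in
  absolute value, on account of its closeness to the direction \<open>\<tau>\<close>.\<close>
definition hits :: "real \<Rightarrow> real \<Rightarrow> real \<times> real \<Rightarrow> real set" where
  "hits t \<tau> v = {s. fst v ^ n * \<bar>p (snd v + s)\<bar> < t \<and>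
     \<bar>sin (snd v + s - \<tau>)\<bar> \<le> C * \<bar>p (snd v + s)\<bar>}"

lemma hitsD:
  assumes "s \<in> hits t \<tau> (r, \<phi>)" "0 < r"
  shows "r ^ n * \<bar>p (\<phi> + s)\<bar> < t" "\<bar>sin (\<phi> + s - \<tau>)\<bar> \<le> C * t / r ^ n"
proof -
  show 1: "r ^ n * \<bar>p (\<phi> + s)\<bar> < t" using assms by (simp add: hits_def)
  then have "\<bar>p (\<phi> + s)\<bar> \<le> t / r ^ n" using assms(2) by (simp add: field_simps)
  then have "C * \<bar>p (\<phi> + s)\<bar> \<le> C * (t / r ^ n)" using C by (intro mult_left_mono) auto
  then show "\<bar>sin (\<phi> + s - \<tau>)\<bar> \<le> C * t / r ^ n" using assms by (simp add: hits_def)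
qed

lemma hits_exists:
  assumes "r ^ n * \<bar>p (\<phi> + s)\<bar> < t"
  shows "\<exists>\<tau>\<in>\<Theta>. s \<in> hits t \<tau> (r, \<phi>)"
  using near[of "\<phi> + s"] assms by (auto simp: hits_def)

lemma card_\<Theta>: "card \<Theta> \<ge> 1"
  using near[of 0] fin by (metis One_nat_def Suc_leI card_gt_0_iff empty_iff)

text \<open>The determinant of two vectors that come close to the same direction \<open>\<tau>\<close> at nearby angles
  is less than \<open>1\<close>.\<close>
lemma hits_collinear:
  assumes W: "separated W" "(r, \<phi>) \<in> W" "(r', \<phi>') \<in> W"
    and h: "s \<in> hits t \<tau> (r, \<phi>)" "s' \<in> hits t \<tau> (r', \<phi>')"
    and R: "r \<le> R" "r' \<le> R" and \<rho>: "\<bar>s - s'\<bar> \<le> \<rho>"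
    and \<eta>: "t \<le> \<eta> * r ^ (n - 1)" "t \<le> \<eta> * r' ^ (n - 1)"
    and small: "2 * R * C * \<eta> + R\<^sup>2 * \<rho> < 1"
  shows "sin (\<phi> - \<phi>') = 0"
proof (rule ccontr)
  assume ne: "sin (\<phi> - \<phi>') \<noteq> 0"
  have r: "0 < r" "0 < r'" using W separated_pos by blast+
  have pow: "x ^ n = x * x ^ (n - 1)" for x :: real
    using n by (metis power_eq_if not_numeral_le_zero)
  have e: "((\<phi> + s - \<tau>) - (\<phi>' + s' - \<tau>)) - (s - s') = \<phi> - \<phi>'" by simp
  have "\<bar>sin (\<phi> - \<phi>')\<bar> \<le> \<bar>sin (\<phi> + s - \<tau>)\<bar> + \<bar>sin (\<phi>' + s' - \<tau>)\<bar> + \<bar>sin (s - s')\<bar>"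
    using abs_sin_diff_le[of "(\<phi> + s - \<tau>) - (\<phi>' + s' - \<tau>)" "s - s'"]
      abs_sin_diff_le[of "\<phi> + s - \<tau>" "\<phi>' + s' - \<tau>"] unfolding e by linarith
  also have "\<bar>sin (s - s')\<bar> \<le> \<rho>" using abs_sin_x_le_abs_x[of "s - s'"] \<rho> by linarith
  finally have *: "\<bar>sin (\<phi> - \<phi>')\<bar> \<le> C * t / r ^ n + C * t / r' ^ n + \<rho>"
    using hitsD[OF h(1) r(1)] hitsD[OF h(2) r(2)] by linarith
  have bound: "x * y * (C * t / x ^ n) \<le> R * (C * \<eta>)"
    if "0 < x" "0 < y" "y \<le> R" "t \<le> \<eta> * x ^ (n - 1)" for x y
  proof -
    have "x * y * (C * t / x ^ n) = y * (C * (t / x ^ (n - 1)))"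
      using that by (simp add: pow)
    also have "\<dots> \<le> y * (C * \<eta>)"
      using that C by (intro mult_left_mono) (auto simp: field_simps)
    also have "\<dots> \<le> R * (C * \<eta>)"
    proof (rule mult_right_mono)
      have "0 \<le> r ^ n * \<bar>p (\<phi> + s)\<bar>" using r by simp
      then have "0 < t" using hitsD[OF h(1) r(1)] by linarith
      then have "0 < \<eta> * x ^ (n - 1)" using that by linarith
      then have "0 < \<eta>" using that by (simp add: zero_less_mult_iff)
      then show "0 \<le> C * \<eta>" using C by simp
    qed (use that in auto)
    finally show ?thesis .
  qed
  have "r * r' \<le> R * R" using r R by (intro mult_mono) auto
  then have 3: "r * r' * \<rho> \<le> R\<^sup>2 * \<rho>"
    using \<rho> unfolding power2_eq_square by (intro mult_right_mono) auto
  have "1 \<le> r * r' * \<bar>sin (\<phi> - \<phi>')\<bar>" using separatedD[OF W ne] .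
  also have "\<dots> \<le> r * r' * (C * t / r ^ n + C * t / r' ^ n + \<rho>)"
    using * r by (intro mult_left_mono) auto
  also have "\<dots> = r * r' * (C * t / r ^ n) + r' * r * (C * t / r' ^ n) + r * r' * \<rho>"
    by (simp add: algebra_simps)
  also have "\<dots> \<le> R * (C * \<eta>) + R * (C * \<eta>) + R\<^sup>2 * \<rho>"
    using bound[of r r'] bound[of r' r] r R \<eta> 3 by linarith
  also have "\<dots> = 2 * R * C * \<eta> + R\<^sup>2 * \<rho>" by simp
  finally show False using small by linarith
qed

lemma hits_diam:
  assumes "sin (\<phi> - \<phi>') = 0" "0 < r" "0 < r'"
    and "s \<in> hits t \<tau> (r, \<phi>)" "s' \<in> hits t \<tau> (r', \<phi>')" "\<bar>s - s'\<bar> \<le> 1"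
  shows "\<bar>s - s'\<bar> \<le> 2 * (C * t / r ^ n + C * t / r' ^ n)"
proof -
  have e: "s - s' + (\<phi> - \<phi>') = (\<phi> + s - \<tau>) - (\<phi>' + s' - \<tau>)" by simp
  have "\<bar>s - s'\<bar> \<le> 2 * \<bar>sin (s - s')\<bar>" using assms by (intro abs_le_twice_sin)
  moreover have "\<bar>sin (s - s')\<bar> = \<bar>sin ((\<phi> + s - \<tau>) - (\<phi>' + s' - \<tau>))\<bar>"
    using abs_sin_add_of_sin_eq_0[OF assms(1), of "s - s'"] unfolding e by simp
  moreover have "\<bar>sin ((\<phi> + s - \<tau>) - (\<phi>' + s' - \<tau>))\<bar> \<le> C * t / r ^ n + C * t / r' ^ n"
    by (rule order_trans[OF abs_sin_diff_le add_mono])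
      (rule hitsD(2)[OF assms(4,2)], rule hitsD(2)[OF assms(5,3)])
  then have "2 * \<bar>sin ((\<phi> + s - \<tau>) - (\<phi>' + s' - \<tau>))\<bar> \<le> 2 * (C * t / r ^ n + C * t / r' ^ n)"
    by (rule mult_left_mono) simp
  ultimately show ?thesis by (metis order_trans)
qed

text \<open>After rotation by \<open>s\<close>, all vectors of \<open>W\<close> of length at most \<open>R\<close> have form value at least
  \<open>t\<close> in absolute value.\<close>
definition avoids :: "(real \<times> real) set \<Rightarrow> real \<Rightarrow> real \<Rightarrow> real \<Rightarrow> bool" where
  "avoids W t R s \<longleftrightarrow> (\<forall>(r, \<phi>)\<in>W. r \<le> R \<longrightarrow> t \<le> r ^ n * \<bar>p (\<phi> + s)\<bar>)"

lemma avoidsD: "avoids W t R s \<Longrightarrow> (r, \<phi>) \<in> W \<Longrightarrow> r \<le> R \<Longrightarrow> t \<le> r ^ n * \<bar>p (\<phi> + s)\<bar>"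
  unfolding avoids_def by blast

lemma avoids_if_no_hits:
  assumes "\<And>\<tau> r \<phi>. \<tau> \<in> \<Theta> \<Longrightarrow> (r, \<phi>) \<in> W \<Longrightarrow> r \<le> R \<Longrightarrow> s \<notin> hits t \<tau> (r, \<phi>)"
  shows "avoids W t R s"
  unfolding avoids_def using assms hits_exists by (force simp: not_less[symmetric])

text \<open>The step of the nested interval construction: vectors up to length \<open>Q\<close> are avoided on an
  interval of length \<open>\<beta> / Q\<^sup>2\<close>, and this is continued to length \<open>K * Q\<close>.  For each
  direction, the vectors of length between \<open>Q\<close> and \<open>K * Q\<close> that are bad somewhere on the interval
  are parallel, so that their bad angles form one short set \<open>S \<tau>\<close>.\<close>
lemma avoids_refine:
  fixes K :: real
  defines "K \<equiv> 3 ^ card \<Theta>"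
  assumes W: "separated W" and Q: "0 < Q" and \<beta>: "0 < \<beta>" "4 * K\<^sup>2 * \<beta> \<le> 1" "\<beta> \<le> Q\<^sup>2"
    and c: "0 < c" "4 * C * K * c < \<beta>" and t: "t \<le> c * Q ^ (n - 2)"
    and av: "\<And>s. s \<in> {a..a + \<beta> / Q\<^sup>2} \<Longrightarrow> avoids W t Q s"
  shows "\<exists>b\<ge>a. b + \<beta> / (K * Q)\<^sup>2 \<le> a + \<beta> / Q\<^sup>2 \<and>
     (\<forall>s\<in>{b..b + \<beta> / (K * Q)\<^sup>2}. avoids W t (K * Q) s)"
proof -
  let ?l = "\<beta> / Q\<^sup>2"
  let ?J = "{a..a + ?l}"
  have K: "1 \<le> K" by (simp add: K_def)
  have l: "0 < ?l" "?l \<le> 1" using \<beta> Q by auto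
  define S where "S \<tau> = {s \<in> ?J. \<exists>(r, \<phi>)\<in>W. r \<le> K * Q \<and> s \<in> hits t \<tau> (r, \<phi>)}" for \<tau>
  have pow: "x ^ n = x\<^sup>2 * x ^ (n - 2)" "x ^ (n - 1) = x * x ^ (n - 2)" for x :: real
  proof -
    have e: "n = 2 + (n - 2)" "n - 1 = 1 + (n - 2)" using n by auto
    show "x ^ n = x\<^sup>2 * x ^ (n - 2)" by (subst e(1), subst power_add) simp
    show "x ^ (n - 1) = x * x ^ (n - 2)" by (subst e(2), subst power_add) simp
  qed
  have large: "Q < r" if "s \<in> ?J" "(r, \<phi>) \<in> W" "s \<in> hits t \<tau> (r, \<phi>)" for s r \<phi> \<tau>
  proof (rule ccontr)
    assume "\<not> Q < r"
    then have "t \<le> r ^ n * \<bar>p (\<phi> + s)\<bar>" using avoidsD[OF av[OF that(1)] that(2)] by simp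
    then show False using that(3) by (simp add: hits_def)
  qed
  have short: "\<bar>x - y\<bar> < ?l / K" if \<tau>: "\<tau> \<in> \<Theta>" and xy: "x \<in> S \<tau>" "y \<in> S \<tau>" for \<tau> x y
  proof -
    obtain r \<phi> where v: "(r, \<phi>) \<in> W" "r \<le> K * Q" "x \<in> hits t \<tau> (r, \<phi>)" "x \<in> ?J"
      using xy(1) by (auto simp: S_def)
    obtain r' \<phi>' where v': "(r', \<phi>') \<in> W" "r' \<le> K * Q" "y \<in> hits t \<tau> (r', \<phi>')" "y \<in> ?J"
      using xy(2) by (auto simp: S_def)
    have r: "Q < r" "Q < r'" using large v v' by blast+
    have d: "\<bar>x - y\<bar> \<le> ?l" using v(4) v'(4) by auto
    have tr: "t \<le> c / Q * x ^ (n - 1)" "C * t / x ^ n \<le> C * c / Q\<^sup>2" if "Q < x" for x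
    proof -
      have q: "Q ^ (n - 2) \<le> x ^ (n - 2)" using that Q by (intro power_mono) auto
      have "1 * Q ^ (n - 2) \<le> x / Q * x ^ (n - 2)"
        using that Q q by (intro mult_mono) auto
      then have "c * Q ^ (n - 2) \<le> c * (x / Q * x ^ (n - 2))"
        using c by (intro mult_left_mono) auto
      then show "t \<le> c / Q * x ^ (n - 1)" using t unfolding pow by simp
      have "t \<le> c * x ^ (n - 2)" using t mult_left_mono[OF q, of c] c by linarith
      then have "t / x ^ (n - 2) \<le> c" using that Q by (simp add: field_simps)
      then have "C * (t / x ^ (n - 2)) / x\<^sup>2 \<le> C * c / x\<^sup>2"
        using C by (intro divide_right_mono mult_left_mono) auto
      also have "\<dots> \<le> C * c / Q\<^sup>2"
        using that Q C c by (intro divide_left_mono power_mono) (auto intro!: mult_pos_pos)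
      finally show "C * t / x ^ n \<le> C * c / Q\<^sup>2" by (simp add: pow mult.commute)
    qed
    have "sin (\<phi> - \<phi>') = 0"
    proof (rule hits_collinear[OF W v(1) v'(1) v(3) v'(3) v(2) v'(2) d tr(1)[OF r(1)] tr(1)[OF r(2)]])
      have "2 * (K * Q) * C * (c / Q) = (4 * C * K * c) / 2" using Q by simp
      also have "\<dots> < \<beta> / 2" using c by simp
      also have "\<dots> \<le> K\<^sup>2 * \<beta> / 2"
        using K \<beta>(1) mult_right_mono[of 1 "K\<^sup>2" \<beta>] by auto
      finally have "2 * (K * Q) * C * (c / Q) < 1 / 8" using \<beta> by linarith
      moreover have "(K * Q)\<^sup>2 * ?l = K\<^sup>2 * \<beta>" using Q by (simp add: power_mult_distrib)
      ultimately show "2 * (K * Q) * C * (c / Q) + (K * Q)\<^sup>2 * ?l < 1" using \<beta> by linarith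
    qed
    from hits_diam[OF this _ _ v(3) v'(3)] have "\<bar>x - y\<bar> \<le> 2 * (C * t / r ^ n + C * t / r' ^ n)"
      using r Q d l by auto
    also have "\<dots> \<le> 2 * (C * c / Q\<^sup>2 + C * c / Q\<^sup>2)"
      using tr(2)[OF r(1)] tr(2)[OF r(2)] by (intro mult_left_mono add_mono) auto
    also have "\<dots> = (4 * C * K * c) / Q\<^sup>2 / K" using K by simp
    also have "\<dots> < ?l / K" using c Q K by (intro divide_strict_right_mono) auto
    finally show ?thesis .
  qed
  have "\<exists>b\<ge>a. b + ?l / K \<le> a + ?l \<and> (\<forall>\<tau>\<in>\<Theta>. {b..b + ?l / K} \<inter> S \<tau> = {})"
    unfolding K_def
    by (rule avoid_short_sets[OF fin short]) (use K l in \<open>simp_all add: K_def\<close>)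
  then obtain b where b: "b \<ge> a" "b + ?l / K \<le> a + ?l" "\<forall>\<tau>\<in>\<Theta>. {b..b + ?l / K} \<inter> S \<tau> = {}"
    by blast
  have sh: "\<beta> / (K * Q)\<^sup>2 \<le> ?l / K"
  proof -
    have "?l / K\<^sup>2 \<le> ?l / K"
      using l K self_le_power[of K 2] by (intro divide_left_mono) auto
    then show ?thesis by (simp add: power_mult_distrib mult.commute)
  qed
  have "avoids W t (K * Q) s" if "s \<in> {b..b + \<beta> / (K * Q)\<^sup>2}" for s
  proof (rule avoids_if_no_hits)
    fix \<tau> r \<phi>
    assume A: "\<tau> \<in> \<Theta>" "(r, \<phi>) \<in> W" "r \<le> K * Q"
    have "s \<in> {b..b + ?l / K}" using that sh by auto
    then have "s \<notin> S \<tau>" "s \<in> ?J" using b(1,2) bspec[OF b(3) A(1)] by (blast, auto)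
    then show "s \<notin> hits t \<tau> (r, \<phi>)" using A unfolding S_def by blast
  qed
  then show ?thesis using b sh by (intro exI[of _ b]) auto
qed


lemma exists_avoiding:
  fixes K :: real
  defines "K \<equiv> 3 ^ card \<Theta>"
  assumes W: "separated W" and Q: "0 < Q" and \<beta>: "0 < \<beta>" "4 * K\<^sup>2 * \<beta> \<le> 1" "\<beta> \<le> Q\<^sup>2"
    and c: "0 < c" "4 * C * K * c < \<beta>" and t: "t \<le> c * Q ^ (n - 2)"
    and av: "\<And>s. s \<in> {a..a + \<beta> / Q\<^sup>2} \<Longrightarrow> avoids W t Q s"
  shows "\<exists>s\<in>{a..a + \<beta> / Q\<^sup>2}. \<forall>R. avoids W t R s"
proof -
  have K1: "1 \<le> K" by (simp add: K_def)
  have "(3::real) ^ 1 \<le> K" unfolding K_def using card_\<Theta> by (intro power_increasing) auto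
  then have K: "1 < K" by simp
  \<comment> \<open>The interval of stage \<open>k\<close> starts at \<open>f k\<close> and has length \<open>\<beta> / (q k)\<^sup>2\<close>.\<close>
  define q where "q k = K ^ k * Q" for k
  have q: "Q \<le> q k" for k
    using Q K1 mult_right_mono[of 1 "K ^ k" Q] by (auto simp: q_def)
  have qS: "q (Suc k) = K * q k" for k by (simp add: q_def)
  define good where "good k a \<longleftrightarrow> (\<forall>s\<in>{a..a + \<beta> / (q k)\<^sup>2}. avoids W t (q k) s)" for k a
  have "\<exists>f. f 0 = a \<and> (\<forall>k. good k (f k) \<and>
    (f k \<le> f (Suc k) \<and> f (Suc k) + \<beta> / (q (Suc k))\<^sup>2 \<le> f k + \<beta> / (q k)\<^sup>2))"
  proof -
    have "\<exists>f. \<forall>k. (good k (f k) \<and> (k = 0 \<longrightarrow> f k = a)) \<and>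
      (f k \<le> f (Suc k) \<and> f (Suc k) + \<beta> / (q (Suc k))\<^sup>2 \<le> f k + \<beta> / (q k)\<^sup>2)"
    proof (rule dependent_nat_choice)
      show "\<exists>x. good 0 x \<and> (0 = 0 \<longrightarrow> x = a)"
        using av by (auto simp: good_def q_def)
    next
      fix x k
      assume "good k x \<and> (k = 0 \<longrightarrow> x = a)"
      then have g: "\<And>s. s \<in> {x..x + \<beta> / (q k)\<^sup>2} \<Longrightarrow> avoids W t (q k) s"
        by (auto simp: good_def)
      have pos: "0 < q k" using q[of k] Q by linarith
      have \<beta>': "\<beta> \<le> (q k)\<^sup>2"
        using power_mono[OF q[of k], of 2] Q \<beta> by linarith
      have "Q ^ (n - 2) \<le> q k ^ (n - 2)" using q Q by (intro power_mono) auto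
      then have "c * Q ^ (n - 2) \<le> c * q k ^ (n - 2)" using c by (intro mult_left_mono) auto
      then have t': "t \<le> c * q k ^ (n - 2)" using t by linarith
      obtain b where "b \<ge> x" "b + \<beta> / (q (Suc k))\<^sup>2 \<le> x + \<beta> / (q k)\<^sup>2"
          "\<forall>s\<in>{b..b + \<beta> / (q (Suc k))\<^sup>2}. avoids W t (q (Suc k)) s"
        using avoids_refine[OF W pos \<beta>(1) _ \<beta>' c(1) _ t' g] \<beta>(2) c(2) unfolding K_def[symmetric] qS
        by auto
      then show "\<exists>y. (good (Suc k) y \<and> (Suc k = 0 \<longrightarrow> y = a)) \<and>
          x \<le> y \<and> y + \<beta> / (q (Suc k))\<^sup>2 \<le> x + \<beta> / (q k)\<^sup>2"
        unfolding good_def by blast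
    qed
    then show ?thesis by blast
  qed
  then obtain f where f: "f 0 = a" "\<And>k. good k (f k)" "\<And>k. f k \<le> f (Suc k)"
      "\<And>k. f (Suc k) + \<beta> / (q (Suc k))\<^sup>2 \<le> f k + \<beta> / (q k)\<^sup>2" by blast
  have inc: "incseq f" using f(3) by (rule incseq_SucI)
  have dec: "decseq (\<lambda>k. f k + \<beta> / (q k)\<^sup>2)" using f(4) by (rule decseq_SucI)
  have len: "0 \<le> \<beta> / (q k)\<^sup>2" for k using \<beta> by simp
  have le: "f j \<le> f k + \<beta> / (q k)\<^sup>2" for j k
  proof (cases "j \<le> k")
    case True
    then show ?thesis using incseqD[OF inc True] len[of k] by linarith
  next
    case False
    then show ?thesis using decseqD[OF dec, of k j] len[of j] by auto
  qed
  define s where "s = (SUP k. f k)"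
  have bdd: "bdd_above (range f)" using le[of _ 0] by (intro bdd_aboveI) auto
  have s: "s \<in> {f k..f k + \<beta> / (q k)\<^sup>2}" for k
    unfolding s_def using le[of _ k] bdd by (auto intro: cSUP_upper cSUP_least)
  have "avoids W t R s" for R
  proof -
    obtain k where "R / Q < K ^ k" using real_arch_pow[OF K] by blast
    then have "R < q k" using Q by (simp add: q_def field_simps)
    moreover have "avoids W t (q k) s" using f(2)[of k] s[of k] by (auto simp: good_def)
    ultimately show ?thesis by (force simp: avoids_def)
  qed
  moreover have "s \<in> {a..a + \<beta> / Q\<^sup>2}" using s[of 0] f(1) by (simp add: q_def)
  ultimately show ?thesis by blast
qed

text \<open>The initial interval next to \<open>s\<close> comes from \<open>avoid_sparse_sets\<close>.  It has length
  \<open>\<kappa> * \<rho>\<close>, so the nested construction takes over at the length \<open>R\<close> with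
  \<open>R\<^sup>2 * (\<kappa> * \<rho>) = \<beta>\<close>.  Vectors that are bad in \<open>(s, s + \<rho>]\<close> have \<open>r ^ n\<close> at least of
  order \<open>1 / \<rho>\<close>, and those with \<open>r \<le> R\<close> are parallel for each direction, provided that
  \<open>R / r ^ (n - 1)\<close> is small.  With \<open>\<rho> = \<mu> ^ 6\<close> this quotient is of order at most
  \<open>\<mu>\<close> for \<open>n \<ge> 3\<close>, and no fractional powers occur.\<close>
lemma exists_avoiding_after:
  assumes W: "separated W" and t: "0 < t" "t < t'"
    and s: "\<And>R. avoids W t' R s" and \<epsilon>: "0 < \<epsilon>"
  shows "\<exists>s'>s. s' \<le> s + \<epsilon> \<and> (\<forall>R. avoids W t R s')"
proof -
  define \<delta> where "\<delta> = (t' - t) / B"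
  have \<delta>: "0 < \<delta>" using t B by (simp add: \<delta>_def)
  define k where "k = min 1 \<delta>"
  have k: "0 < k" "k \<le> 1" "k ^ 3 \<le> \<delta>"
  proof -
    show "0 < k" "k \<le> 1" using \<delta> by (auto simp: k_def)
    then have "k ^ 3 \<le> k ^ 1" by (intro power_decreasing) auto
    then show "k ^ 3 \<le> \<delta>" by (simp add: k_def)
  qed
  define A where "A = 4 * C * t / \<delta>"
  have A: "0 \<le> A" using C t \<delta> by (simp add: A_def)
  obtain \<kappa> where \<kappa>: "\<kappa> > 0" "\<kappa> \<le> 1" and sparse: "\<And>S \<rho>. 0 < \<rho> \<Longrightarrow>
           (\<forall>\<tau>\<in>\<Theta>. \<forall>x\<in>S \<tau>. \<forall>y\<in>S \<tau>. y - x \<le> A * (x - s)) \<Longrightarrow>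
           (\<exists>a>s. a + \<kappa> * \<rho> \<le> s + \<rho> \<and> (\<forall>\<tau>\<in>\<Theta>. {a..a + \<kappa> * \<rho>} \<inter> S \<tau> = {}))"
    using avoid_sparse_sets[OF fin A, of s] by blast
  define K :: real where "K = 3 ^ card \<Theta>"
  have K: "1 \<le> K" by (simp add: K_def)
  define \<beta> where "\<beta> = min (1 / (4 * K\<^sup>2)) (\<kappa> / 4)"
  have \<beta>: "0 < \<beta>" "4 * K\<^sup>2 * \<beta> \<le> 1" "\<beta> \<le> \<kappa> / 4"
  proof -
    show "0 < \<beta>" "\<beta> \<le> \<kappa> / 4" using K \<kappa> by (auto simp: \<beta>_def)
    have "4 * K\<^sup>2 * \<beta> \<le> 4 * K\<^sup>2 * (1 / (4 * K\<^sup>2))"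
      unfolding \<beta>_def by (intro mult_left_mono) auto
    then show "4 * K\<^sup>2 * \<beta> \<le> 1" using K by simp
  qed
  define c where "c = \<beta> / (8 * C * K)"
  have c: "0 < c" "4 * C * K * c < \<beta>" using \<beta> C K by (auto simp: c_def)
  define g where "g = sqrt (\<beta> / \<kappa>)"
  have g: "0 < g" "g\<^sup>2 = \<beta> / \<kappa>" using \<beta> \<kappa> by (auto simp: g_def)
  have g1: "g \<le> 1 / 2"
  proof (rule power2_le_imp_le)
    show "g\<^sup>2 \<le> (1 / 2)\<^sup>2" using \<beta> \<kappa> unfolding g by (simp add: field_simps power2_eq_square)
  qed simp
  define \<mu> where "\<mu> = Min {1, \<epsilon>, k, g, g * c / t, k\<^sup>2 / (8 * C * t)}"
  have \<mu>: "0 < \<mu>" "\<mu> \<le> 1" "\<mu> \<le> \<epsilon>" "\<mu> \<le> k" "\<mu> \<le> g" "\<mu> \<le> g * c / t" "\<mu> \<le> k\<^sup>2 / (8 * C * t)"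
    unfolding \<mu>_def using \<epsilon> k g c t C by auto
  have \<mu>_pow: "\<mu> ^ j \<le> \<mu>" if "1 \<le> j" for j
    using power_decreasing[of 1 j \<mu>] that \<mu> by simp
  define \<rho> where "\<rho> = \<mu> ^ 6"
  define R where "R = g / \<mu> ^ 3"
  have \<rho>: "0 < \<rho>" "\<rho> \<le> 1" "\<rho> \<le> \<epsilon>" "\<rho> \<le> k ^ 3"
  proof -
    show "0 < \<rho>" "\<rho> \<le> 1" "\<rho> \<le> \<epsilon>" using \<mu> \<mu>_pow[of 6] by (auto simp: \<rho>_def)
    have "\<rho> \<le> \<mu> ^ 3" unfolding \<rho>_def using \<mu> by (intro power_decreasing) auto
    also have "\<dots> \<le> k ^ 3" using \<mu> by (intro power_mono) auto
    finally show "\<rho> \<le> k ^ 3" .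
  qed
  have R2: "R\<^sup>2 * (\<kappa> * \<rho>) = \<beta>"
    using \<mu> \<kappa> unfolding R_def \<rho>_def power_divide g by (simp flip: power_mult)
  have R_ge: "1 \<le> R" "t / c \<le> R"
  proof -
    have "\<mu> ^ 3 \<le> g" using \<mu>_pow[of 3] \<mu> by linarith
    then show "1 \<le> R" using \<mu> by (simp add: R_def field_simps)
    have "t / c * \<mu> ^ 3 \<le> t / c * \<mu>" using \<mu>_pow[of 3] t c by (intro mult_left_mono) auto
    also have "\<dots> \<le> t / c * (g * c / t)" using \<mu> t c by (intro mult_left_mono) auto
    also have "\<dots> = g" using t c by simp
    finally show "t / c \<le> R" using \<mu> by (simp add: R_def pos_le_divide_eq)
  qed
  define \<eta> where "\<eta> = t * \<mu> ^ 4 / k\<^sup>2"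
  have far: "\<delta> \<le> r ^ n * (x - s)"
    if "(r, \<phi>) \<in> W" "r ^ n * \<bar>p (\<phi> + x)\<bar> < t" "s \<le> x" for r \<phi> x
  proof -
    have r: "0 < r" using W that(1) separated_pos by blast
    have "t' \<le> r ^ n * \<bar>p (\<phi> + s)\<bar>" using avoidsD[OF s that(1), of r] by simp
    moreover have "\<bar>p (\<phi> + s)\<bar> \<le> \<bar>p (\<phi> + x)\<bar> + B * (x - s)"
      using lipschitz[of "\<phi> + s" "\<phi> + x"] that(3) by (auto simp: abs_if split: if_splits)
    then have "r ^ n * \<bar>p (\<phi> + s)\<bar> \<le> r ^ n * (\<bar>p (\<phi> + x)\<bar> + B * (x - s))"
      using r by (intro mult_left_mono) auto
    ultimately have "t' - t \<le> r ^ n * (B * (x - s))"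
      using that(2) by (simp add: distrib_left)
    then show ?thesis using B by (simp add: \<delta>_def pos_divide_le_eq ac_simps)
  qed
  have steep: "t \<le> \<eta> * r ^ (n - 1)"
    if "(r, \<phi>) \<in> W" "r ^ n * \<bar>p (\<phi> + x)\<bar> < t" "s \<le> x" "x \<le> s + \<rho>" for r \<phi> x
  proof -
    have r: "0 < r" using W that(1) separated_pos by blast
    have "\<delta> \<le> r ^ n * \<rho>"
    proof (rule order_trans[OF far[OF that(1-3)] mult_left_mono])
    qed (use that(4) r in auto)
    then have rn: "k ^ 3 \<le> r ^ n * \<rho>" using k by linarith
    have "1 \<le> r"
    proof (rule ccontr)
      assume "\<not> 1 \<le> r"
      then have "r ^ n < 1" using power_decreasing[of 1 n r] r n by simp
      then have "r ^ n * \<rho> < 1 * \<rho>" using \<rho> by (intro mult_strict_right_mono) auto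
      then show False using rn \<rho> by linarith
    qed
    then have "(r ^ n)\<^sup>2 \<le> (r ^ (n - 1)) ^ 3"
      unfolding power_mult[symmetric] using n by (intro power_increasing) auto
    moreover have "(k ^ 3)\<^sup>2 \<le> (r ^ n * \<rho>)\<^sup>2" using rn k by (intro power_mono) auto
    \<comment> \<open>Here \<open>n \<ge> 3\<close> enters, as \<open>2 * n \<le> 3 * (n - 1)\<close>.\<close>
    ultimately have "(k\<^sup>2) ^ 3 \<le> (r ^ (n - 1) * \<mu> ^ 4) ^ 3"
      using mult_right_mono[of "(r ^ n)\<^sup>2" "(r ^ (n - 1)) ^ 3" "\<rho>\<^sup>2"]
      unfolding power_mult_distrib \<rho>_def by (simp flip: power_mult)
    then have "k\<^sup>2 \<le> r ^ (n - 1) * \<mu> ^ 4"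
      unfolding numeral_3_eq_3 by (rule power_le_imp_le_base) (use r \<mu> in auto)
    then have "t * k\<^sup>2 \<le> t * (r ^ (n - 1) * \<mu> ^ 4)" using t by (intro mult_left_mono) auto
    then show ?thesis using k by (simp add: \<eta>_def field_simps)
  qed
  define S where "S \<tau> = {x \<in> {s..s + \<rho>}. \<exists>(r, \<phi>)\<in>W. r \<le> R \<and> x \<in> hits t \<tau> (r, \<phi>)}" for \<tau>
  have "y - x \<le> A * (x - s)" if xy: "x \<in> S \<tau>" "y \<in> S \<tau>" for \<tau> x y
  proof -
    obtain r \<phi> where v: "(r, \<phi>) \<in> W" "r \<le> R" "x \<in> hits t \<tau> (r, \<phi>)" "s \<le> x" "x \<le> s + \<rho>"
      using xy(1) by (auto simp: S_def)
    obtain r' \<phi>' where v': "(r', \<phi>') \<in> W" "r' \<le> R" "y \<in> hits t \<tau> (r', \<phi>')" "s \<le> y" "y \<le> s + \<rho>"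
      using xy(2) by (auto simp: S_def)
    have r: "0 < r" "0 < r'" using W v v' separated_pos by blast+
    note small = hitsD(1)[OF v(3) r(1)] hitsD(1)[OF v'(3) r(2)]
    have d: "\<bar>x - y\<bar> \<le> \<rho>" using v v' by auto
    have par: "sin (\<phi> - \<phi>') = 0"
    proof (rule hits_collinear[OF W v(1) v'(1) v(3) v'(3) v(2) v'(2) d])
      show "t \<le> \<eta> * r ^ (n - 1)" "t \<le> \<eta> * r' ^ (n - 1)"
        using steep[OF v(1) small(1) v(4,5)] steep[OF v'(1) small(2) v'(4,5)] by blast+
      have "2 * R * C * \<eta> = g * (2 * C * t * \<mu>) / k\<^sup>2"
        using \<mu> by (simp add: R_def \<eta>_def field_simps eval_nat_numeral)
      also have "\<dots> \<le> g * (k\<^sup>2 / 4) / k\<^sup>2"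
        using \<mu>(7) C t g by (intro divide_right_mono mult_left_mono) (auto simp: field_simps)
      also have "\<dots> \<le> 1 / 8" using g1 k by simp
      finally have "2 * R * C * \<eta> \<le> 1 / 8" .
      moreover have "R\<^sup>2 * \<rho> = \<beta> / \<kappa>" using R2 \<kappa> by (simp add: field_simps)
      moreover have "\<beta> / \<kappa> \<le> 1 / 4" using \<beta> \<kappa> by (simp add: field_simps)
      ultimately show "2 * R * C * \<eta> + R\<^sup>2 * \<rho> < 1" by linarith
    qed
    have close: "\<bar>x - y\<bar> \<le> 2 * (C * t / r ^ n + C * t / r' ^ n)"
      using hits_diam[OF par r v(3) v'(3)] d \<rho> by linarith
    \<comment> \<open>The shorter of the two parallel vectors is bad at \<open>x\<close> as well, so the distance of \<open>x\<close>
      from \<open>s\<close> is bounded below in terms of its length \<open>q\<close>.\<close>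
    have bound: "\<bar>x - y\<bar> \<le> A * (x - s)"
      if q: "0 < q" "q \<le> r" "q \<le> r'" "\<delta> \<le> q ^ n * (x - s)" for q
    proof -
      have "C * t / r ^ n \<le> C * t / q ^ n" "C * t / r' ^ n \<le> C * t / q ^ n"
        using q C t by (auto intro!: divide_left_mono power_mono mult_pos_pos)
      then have "2 * (C * t / r ^ n + C * t / r' ^ n) \<le> 2 * (C * t / q ^ n + C * t / q ^ n)"
        by (intro mult_left_mono add_mono) auto
      also have "\<dots> = 4 * C * t * (1 / q ^ n)" by simp
      also have "\<dots> \<le> 4 * C * t * ((x - s) / \<delta>)"
        using q C t \<delta> by (intro mult_left_mono) (auto simp: field_simps)
      also have "\<dots> = A * (x - s)" by (simp add: A_def)
      finally show ?thesis using close by (rule order_trans[rotated])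
    qed
    have "\<bar>x - y\<bar> \<le> A * (x - s)"
    proof (cases "r \<le> r'")
      case True
      then show ?thesis using bound[of r] r far[OF v(1) small(1) v(4)] by blast
    next
      case False
      have "\<bar>p (\<phi>' + x)\<bar> = \<bar>p (\<phi> + x)\<bar>" using shift[OF par, of "\<phi>' + x"] by (simp add: add.commute)
      moreover have "r' ^ n * \<bar>p (\<phi> + x)\<bar> \<le> r ^ n * \<bar>p (\<phi> + x)\<bar>"
        using False r by (intro mult_right_mono power_mono) auto
      ultimately have "r' ^ n * \<bar>p (\<phi>' + x)\<bar> < t" using small(1) by simp
      then show ?thesis using bound[of r'] False r far[OF v'(1) _ v(4)] by auto
    qed
    then show ?thesis by linarith
  qed
  then obtain a where a: "s < a" "a + \<kappa> * \<rho> \<le> s + \<rho>" "\<forall>\<tau>\<in>\<Theta>. {a..a + \<kappa> * \<rho>} \<inter> S \<tau> = {}"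
    using sparse[OF \<rho>(1), of S] by blast
  have len: "\<beta> / R\<^sup>2 = \<kappa> * \<rho>" using R2 R_ge by (simp add: field_simps)
  have "avoids W t R x" if "x \<in> {a..a + \<beta> / R\<^sup>2}" for x
  proof (rule avoids_if_no_hits)
    fix \<tau> r \<phi>
    assume h: "\<tau> \<in> \<Theta>" "(r, \<phi>) \<in> W" "r \<le> R"
    have "x \<in> {a..a + \<kappa> * \<rho>}" using that unfolding len .
    moreover from this have "x \<notin> S \<tau>" using bspec[OF a(3) h(1)] by blast
    moreover have "x \<in> {s..s + \<rho>}" using calculation(1) a(1,2) by auto
    ultimately have "x \<in> {s..s + \<rho>}" "x \<notin> S \<tau>" by blast+
    then show "x \<notin> hits t \<tau> (r, \<phi>)" using h unfolding S_def by blast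
  qed
  moreover have "t \<le> c * R ^ (n - 2)"
  proof -
    have "R ^ 1 \<le> R ^ (n - 2)" using R_ge n by (intro power_increasing) auto
    then have "t / c \<le> R ^ (n - 2)" using R_ge by simp
    then show ?thesis using c by (simp add: field_simps)
  qed
  moreover have "\<beta> \<le> R\<^sup>2" using one_le_power[OF R_ge(1), of 2] \<beta>(3) \<kappa> by linarith
  ultimately obtain s' where "s' \<in> {a..a + \<kappa> * \<rho>}" "\<forall>R. avoids W t R s'"
    using exists_avoiding[OF W _ \<beta>(1), of R c t a] \<beta>(2) c R_ge unfolding K_def len by auto
  then show ?thesis using a \<rho> by (intro exI[of _ s']) auto
qed

text \<open>At the initial length \<open>1 / 2\<close> there is no vector to avoid.\<close>
lemma exists_avoiding_positive:
  assumes W: "separated W" and far: "\<And>r \<phi>. (r, \<phi>) \<in> W \<Longrightarrow> 1 \<le> r"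
  shows "\<exists>t>0. \<exists>s. \<forall>R. avoids W t R s"
proof -
  define K :: real where "K = 3 ^ card \<Theta>"
  have K: "1 \<le> K" by (simp add: K_def)
  define \<beta> where "\<beta> = 1 / (4 * K\<^sup>2)"
  have \<beta>: "0 < \<beta>" "4 * K\<^sup>2 * \<beta> \<le> 1" "\<beta> \<le> (1 / 2)\<^sup>2"
    using K one_le_power[OF K, of 2] by (auto simp: \<beta>_def field_simps power2_eq_square)
  define c where "c = \<beta> / (8 * C * K)"
  have c: "0 < c" "4 * C * K * c < \<beta>" using \<beta> C K by (auto simp: c_def)
  define t where "t = c * (1 / 2) ^ (n - 2)"
  have "avoids W t (1 / 2) s" for s
    using far by (force simp: avoids_def)
  then have "\<exists>s\<in>{0..0 + \<beta> / (1 / 2)\<^sup>2}. \<forall>R. avoids W t R s"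
    by (intro exists_avoiding[OF W _ \<beta>(1), where c = c])
      (use \<beta> c in \<open>auto simp: t_def K_def\<close>)
  moreover have "0 < t" using c by (simp add: t_def)
  ultimately show ?thesis by blast
qed

end

section \<open>Binary forms on the unit circle\<close>

text \<open>The vector of all monomials of degree \<open>m + n - 1\<close> at a common zero is in the kernel of the
  Sylvester matrix.  The formal degrees \<open>m\<close> and \<open>n\<close> may exceed the degrees of \<open>f\<close> and \<open>g\<close>,
  which is why zeros with \<open>y = 0\<close> are covered.\<close>
lemma resultant_sub_eq_0_if_common_zero:
  fixes f g :: "'a :: field poly"
  assumes f: "(\<Sum>k\<le>m. coeff f k * x ^ k * y ^ (m - k)) = 0"
    and g: "(\<Sum>k\<le>n. coeff g k * x ^ k * y ^ (n - k)) = 0"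
    and xy: "x \<noteq> 0 \<or> y \<noteq> 0" and mn: "0 < m + n"
  shows "resultant_sub m n f g = 0"
proof -
  define A where "A = sylvester_mat_sub m n f g"
  define v where "v = Matrix.vec (m + n) (\<lambda>j. x ^ (m + n - 1 - j) * y ^ j)"
  have A: "A \<in> carrier_mat (m + n) (m + n)" unfolding A_def by (rule sylvester_mat_sub_carrier)
  have v: "v \<in> carrier_vec (m + n)" by (simp add: v_def)
  have "A *\<^sub>v v = 0\<^sub>v (m + n)"
  proof (rule eq_vecI)
    fix i assume "i < dim_vec (0\<^sub>v (m + n) :: 'a Matrix.vec)"
    then have i: "i < m + n" by simp
    have "vec_index (A *\<^sub>v v) i =
        (\<Sum>j = 0..<m + n. A $$ (i, j) * (x ^ (m + n - 1 - j) * y ^ j))"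
      using A i by (simp add: v_def scalar_prod_def)
    also have "\<dots> = 0"
    proof (cases "i < n")
      case True
      have "(\<Sum>j = 0..<m + n. A $$ (i, j) * (x ^ (m + n - 1 - j) * y ^ j)) =
          (\<Sum>j\<in>{i..i + m}. coeff f (m + i - j) * (x ^ (m + n - 1 - j) * y ^ j))"
        using i True by (intro sum.mono_neutral_cong_right) (auto simp: A_def sylvester_mat_sub_index)
      also have "\<dots> = (\<Sum>k\<le>m. x ^ (n - 1 - i) * y ^ i * (coeff f k * x ^ k * y ^ (m - k)))"
      proof (rule sum.reindex_bij_witness[of _ "\<lambda>k. m + i - k" "\<lambda>j. m + i - j"])
        fix j assume j: "j \<in> {i..i + m}"
        have e: "m + n - 1 - j = (n - 1 - i) + (m + i - j)" "j = i + (m - (m + i - j))"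
          using j True by auto
        have "x ^ (m + n - 1 - j) = x ^ (n - 1 - i) * x ^ (m + i - j)"
          by (subst e(1)) (rule power_add)
        moreover have "y ^ j = y ^ i * y ^ (m - (m + i - j))"
          by (subst e(2)) (rule power_add)
        ultimately show "x ^ (n - 1 - i) * y ^ i * (coeff f (m + i - j) * x ^ (m + i - j) * y ^ (m - (m + i - j))) =
            coeff f (m + i - j) * (x ^ (m + n - 1 - j) * y ^ j)"
          by (simp only: ac_simps)
      qed auto
      also have "\<dots> = 0" unfolding sum_distrib_left[symmetric] f by simp
      finally show ?thesis .
    next
      case False
      have "(\<Sum>j = 0..<m + n. A $$ (i, j) * (x ^ (m + n - 1 - j) * y ^ j)) =
          (\<Sum>j\<in>{i - n..i}. coeff g (i - j) * (x ^ (m + n - 1 - j) * y ^ j))"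
        using i False by (intro sum.mono_neutral_cong_right) (auto simp: A_def sylvester_mat_sub_index)
      also have "\<dots> = (\<Sum>k\<le>n. x ^ (m + n - 1 - i) * y ^ (i - n) * (coeff g k * x ^ k * y ^ (n - k)))"
      proof (rule sum.reindex_bij_witness[of _ "\<lambda>k. i - k" "\<lambda>j. i - j"])
        fix j assume j: "j \<in> {i - n..i}"
        have e: "m + n - 1 - j = (m + n - 1 - i) + (i - j)" "j = (i - n) + (n - (i - j))"
          using j False i by auto
        have "x ^ (m + n - 1 - j) = x ^ (m + n - 1 - i) * x ^ (i - j)"
          by (subst e(1)) (rule power_add)
        moreover have "y ^ j = y ^ (i - n) * y ^ (n - (i - j))"
          by (subst e(2)) (rule power_add)
        ultimately show "x ^ (m + n - 1 - i) * y ^ (i - n) * (coeff g (i - j) * x ^ (i - j) * y ^ (n - (i - j))) =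
            coeff g (i - j) * (x ^ (m + n - 1 - j) * y ^ j)"
          by (simp only: ac_simps)
      qed (use False in auto)
      also have "\<dots> = 0" unfolding sum_distrib_left[symmetric] g by simp
      finally show ?thesis .
    qed
    finally show "vec_index (A *\<^sub>v v) i = vec_index (0\<^sub>v (m + n)) i" using i by simp
  qed (use A in auto)
  moreover have "v \<noteq> 0\<^sub>v (m + n)"
  proof
    assume v0: "v = 0\<^sub>v (m + n)"
    have z: "x ^ (m + n - 1 - j) * y ^ j = 0" if "j < m + n" for j
    proof -
      have "vec_index v j = 0" unfolding v0 using that by simp
      then show ?thesis using that by (simp add: v_def)
    qed
    show False using z[of 0] z[of "m + n - 1"] xy mn by auto
  qed
  ultimately show ?thesis
    using det_0_iff_vec_prod_zero_field[OF A] v unfolding resultant_sub_def A_def by blast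
qed

lemma form_discriminant_eq_0_if_singular:
  fixes x y :: real
  assumes n: "2 \<le> n" and xy: "x \<noteq> 0 \<or> y \<noteq> 0"
    and dx: "(\<Sum>i<n. real (Suc i) * c (Suc i) * x ^ i * y ^ (n - 1 - i)) = 0"
    and dy: "(\<Sum>i<n. real (n - i) * c i * x ^ i * y ^ (n - 1 - i)) = 0"
  shows "form_discriminant n c = 0"
proof -
  have set: "{..n - 1} = {..<n}" using n by auto
  have "coeff (partial_x n c) k = real (Suc k) * c (Suc k)" if "k < n" for k
    using that by (simp add: partial_x_def coeff_sum)
  moreover have "coeff (partial_y n c) k = real (n - k) * c k" if "k < n" for k
    using that by (simp add: partial_y_def coeff_sum)
  ultimately have "resultant_sub (n - 1) (n - 1) (partial_x n c) (partial_y n c) = 0"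
    using n xy dx dy by (intro resultant_sub_eq_0_if_common_zero[where x = x and y = y]) (simp_all add: set[simplified])
  then show ?thesis by (simp add: form_discriminant_def)
qed

lemma binary_form_scale: "binary_form n c (r * x, r * y) = r ^ n * binary_form n c (x, y)"
proof -
  have "c i * (r * x) ^ i * (r * y) ^ (n - i) = r ^ n * (c i * x ^ i * y ^ (n - i))" if "i \<le> n" for i
  proof -
    have "r ^ n = r ^ i * r ^ (n - i)" using that by (simp flip: power_add)
    then show ?thesis by (simp add: power_mult_distrib)
  qed
  then have "(\<Sum>i\<le>n. c i * (r * x) ^ i * (r * y) ^ (n - i)) = (\<Sum>i\<le>n. r ^ n * (c i * x ^ i * y ^ (n - i)))"
    by (intro sum.cong) auto
  then show ?thesis by (simp add: binary_form_def sum_distrib_left)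
qed

text \<open>The restriction of a binary form to the unit circle, as a function of the angle.\<close>
definition on_circle :: "nat \<Rightarrow> (nat \<Rightarrow> real) \<Rightarrow> real \<Rightarrow> real" where
  "on_circle n c \<theta> = binary_form n c (cos \<theta>, sin \<theta>)"

lemma binary_form_polar:
  "binary_form n c (r * cos \<theta>, r * sin \<theta>) = r ^ n * on_circle n c \<theta>"
  by (simp add: on_circle_def binary_form_scale)

lemma on_circle_shift:
  assumes "sin d = 0"
  shows "\<bar>on_circle n c (x + d)\<bar> = \<bar>on_circle n c x\<bar>"
proof -
  have 1: "\<bar>cos d\<bar> = 1" using sin_zero_abs_cos_one assms by blast
  have "on_circle n c (x + d) = binary_form n c (cos d * cos x, cos d * sin x)"
    using assms by (simp add: on_circle_def cos_add sin_add mult.commute)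
  then show ?thesis using 1
    by (simp add: binary_form_polar abs_mult power_abs)
qed

lemma on_circle_lipschitz: "\<exists>B>0. \<forall>x y. \<bar>on_circle n c x - on_circle n c y\<bar> \<le> B * \<bar>x - y\<bar>"
proof (intro exI conjI allI)
  define B where "B = (\<Sum>i\<le>n. \<bar>c i\<bar> * real n) + 1"
  show "0 < B" by (auto simp: B_def intro!: add_nonneg_pos sum_nonneg)
  fix x y :: real
  have cs: "\<bar>cos x - cos y\<bar> \<le> \<bar>x - y\<bar>" "\<bar>sin x - sin y\<bar> \<le> \<bar>x - y\<bar>"
  proof -
    have *: "\<bar>2 * a * sin ((x - y) / 2)\<bar> \<le> \<bar>x - y\<bar>" if "\<bar>a\<bar> \<le> 1" for a
      using mult_mono[OF that abs_sin_x_le_abs_x[of "(x - y) / 2"]] by (simp add: abs_mult)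
    have "sin ((y - x) / 2) = - sin ((x - y) / 2)"
      by (metis minus_diff_eq minus_divide_left sin_minus)
    then show "\<bar>cos x - cos y\<bar> \<le> \<bar>x - y\<bar>"
      using *[of "sin ((x + y) / 2)"] by (simp add: cos_diff_cos abs_mult)
    show "\<bar>sin x - sin y\<bar> \<le> \<bar>x - y\<bar>"
      using *[of "cos ((x + y) / 2)"] by (simp add: sin_diff_sin abs_mult ac_simps)
  qed
  have step: "\<bar>cos x ^ i * sin x ^ (n - i) - cos y ^ i * sin y ^ (n - i)\<bar> \<le> real n * \<bar>x - y\<bar>"
    if "i \<le> n" for i
  proof -
    have "cos x ^ i * sin x ^ (n - i) - cos y ^ i * sin y ^ (n - i) =
        (cos x ^ i - cos y ^ i) * sin x ^ (n - i) + cos y ^ i * (sin x ^ (n - i) - sin y ^ (n - i))"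
      by (simp add: algebra_simps)
    also have "\<bar>\<dots>\<bar> \<le> \<bar>cos x ^ i - cos y ^ i\<bar> * \<bar>sin x ^ (n - i)\<bar> +
        \<bar>cos y ^ i\<bar> * \<bar>sin x ^ (n - i) - sin y ^ (n - i)\<bar>"
      by (metis abs_mult abs_triangle_ineq)
    also have "\<dots> \<le> \<bar>cos x ^ i - cos y ^ i\<bar> + \<bar>sin x ^ (n - i) - sin y ^ (n - i)\<bar>"
      by (intro add_mono mult_right_le_one_le mult_left_le_one_le)
        (auto simp: power_abs power_le_one)
    also have "\<dots> \<le> real i * \<bar>cos x - cos y\<bar> + real (n - i) * \<bar>sin x - sin y\<bar>"
      using norm_power_diff[of "cos x" "cos y" i] norm_power_diff[of "sin x" "sin y" "n - i"]
      by (intro add_mono) auto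
    also have "\<dots> \<le> real i * \<bar>x - y\<bar> + real (n - i) * \<bar>x - y\<bar>"
      using cs by (intro add_mono mult_left_mono) auto
    also have "\<dots> = real n * \<bar>x - y\<bar>" using that by (simp add: of_nat_diff algebra_simps)
    finally show ?thesis .
  qed
  have "\<bar>on_circle n c x - on_circle n c y\<bar> =
      \<bar>\<Sum>i\<le>n. c i * (cos x ^ i * sin x ^ (n - i) - cos y ^ i * sin y ^ (n - i))\<bar>"
    by (simp add: on_circle_def binary_form_def sum_subtractf algebra_simps)
  also have "\<dots> \<le> (\<Sum>i\<le>n. \<bar>c i\<bar> * (real n * \<bar>x - y\<bar>))"
    using step by (intro order_trans[OF sum_abs] sum_mono) (auto simp: abs_mult intro!: mult_left_mono)
  also have "\<dots> \<le> B * \<bar>x - y\<bar>" by (simp add: B_def distrib_right sum_distrib_right mult.assoc)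
  finally show "\<bar>on_circle n c x - on_circle n c y\<bar> \<le> B * \<bar>x - y\<bar>" .
qed

lemma on_circle_deriv:
  assumes n: "1 \<le> n"
  shows "(on_circle n c has_real_derivative
    (\<Sum>i<n. real (n - i) * c i * cos x ^ i * sin x ^ (n - 1 - i)) * cos x
     - (\<Sum>i<n. real (Suc i) * c (Suc i) * cos x ^ i * sin x ^ (n - 1 - i)) * sin x) (at x)"
proof -
  let ?D = "\<lambda>i. c i * (real (n - i) * cos x ^ i * sin x ^ (n - i - 1) * cos x)
      - c i * (real i * cos x ^ (i - 1) * sin x ^ (n - i) * sin x)"
  have "((\<lambda>x. \<Sum>i\<le>n. c i * cos x ^ i * sin x ^ (n - i)) has_real_derivative (\<Sum>i\<le>n. ?D i)) (at x)"
    by (auto intro!: derivative_eq_intros sum.cong simp: algebra_simps)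
  moreover have "(\<Sum>i\<le>n. ?D i) =
     (\<Sum>i\<le>n. c i * (real (n - i) * cos x ^ i * sin x ^ (n - i - 1) * cos x)) -
     (\<Sum>i\<le>n. c i * (real i * cos x ^ (i - 1) * sin x ^ (n - i) * sin x))"
    by (rule sum_subtractf)
  moreover have "(\<Sum>i\<le>n. c i * (real (n - i) * cos x ^ i * sin x ^ (n - i - 1) * cos x)) =
     (\<Sum>i<n. real (n - i) * c i * cos x ^ i * sin x ^ (n - 1 - i)) * cos x"
    unfolding sum_distrib_right
    by (rule sum.mono_neutral_cong_right) (auto simp: algebra_simps)
  moreover have "(\<Sum>i\<le>n. c i * (real i * cos x ^ (i - 1) * sin x ^ (n - i) * sin x)) =
     (\<Sum>i<n. real (Suc i) * c (Suc i) * cos x ^ i * sin x ^ (n - 1 - i)) * sin x"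
  proof -
    obtain m where m: "n = Suc m" using n by (cases n) auto
    show ?thesis unfolding m sum.atMost_Suc_shift sum_distrib_right
      by (simp add: lessThan_Suc_atMost algebra_simps)
  qed
  moreover have "on_circle n c = (\<lambda>x. \<Sum>i\<le>n. c i * cos x ^ i * sin x ^ (n - i))"
    by (simp add: on_circle_def binary_form_def fun_eq_iff)
  ultimately show ?thesis by simp
qed

text \<open>If the derivative vanished at a zero, then so would the tangential and (by Euler's identity)
  the radial component of the gradient, against the discriminant being non-zero.\<close>
lemma on_circle_simple_zeros:
  assumes n: "2 \<le> n" and disc: "form_discriminant n c \<noteq> 0" and zero: "on_circle n c x = 0"
  obtains d where "(on_circle n c has_real_derivative d) (at x)" "d \<noteq> 0"
proof -
  define Px where "Px = (\<Sum>i<n. real (Suc i) * c (Suc i) * cos x ^ i * sin x ^ (n - 1 - i))"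
  define Py where "Py = (\<Sum>i<n. real (n - i) * c i * cos x ^ i * sin x ^ (n - 1 - i))"
  have deriv: "(on_circle n c has_real_derivative Py * cos x - Px * sin x) (at x)"
    unfolding Px_def Py_def using n by (intro on_circle_deriv) auto
  have "Py * cos x - Px * sin x \<noteq> 0"
  proof
    assume tangential: "Py * cos x - Px * sin x = 0"
    have "cos x * Px = (\<Sum>i<n. real (Suc i) * c (Suc i) * cos x ^ Suc i * sin x ^ (n - Suc i))"
      unfolding Px_def sum_distrib_left by (intro sum.cong) auto
    also have "\<dots> = (\<Sum>i\<in>{1..n}. real i * c i * cos x ^ i * sin x ^ (n - i))"
      by (rule sum.reindex_bij_witness[of _ "\<lambda>i. i - 1" Suc]) auto
    also have "\<dots> = (\<Sum>i\<le>n. real i * c i * cos x ^ i * sin x ^ (n - i))"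
      by (rule sum.mono_neutral_left) auto
    finally have 1: "cos x * Px = (\<Sum>i\<le>n. real i * c i * cos x ^ i * sin x ^ (n - i))" .
    have "sin x * Py = (\<Sum>i<n. real (n - i) * c i * cos x ^ i * sin x ^ (n - i))"
      unfolding Py_def sum_distrib_left
    proof (intro sum.cong refl)
      fix i assume "i \<in> {..<n}"
      then have "sin x ^ (n - i) = sin x * sin x ^ (n - 1 - i)"
        by (metis Suc_diff_Suc diff_Suc_eq_diff_pred lessThan_iff power_Suc)
      then show "sin x * (real (n - i) * c i * cos x ^ i * sin x ^ (n - 1 - i)) =
          real (n - i) * c i * cos x ^ i * sin x ^ (n - i)" by simp
    qed
    also have "\<dots> = (\<Sum>i\<le>n. real (n - i) * c i * cos x ^ i * sin x ^ (n - i))"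
      by (rule sum.mono_neutral_left) auto
    finally have "cos x * Px + sin x * Py =
        (\<Sum>i\<le>n. real i * c i * cos x ^ i * sin x ^ (n - i) +
           real (n - i) * c i * cos x ^ i * sin x ^ (n - i))"
      using 1 by (simp add: sum.distrib)
    also have "\<dots> = (\<Sum>i\<le>n. real n * (c i * cos x ^ i * sin x ^ (n - i)))"
      by (intro sum.cong refl) (auto simp: of_nat_diff algebra_simps)
    also have "\<dots> = real n * on_circle n c x"
      by (simp add: on_circle_def binary_form_def sum_distrib_left)
    finally have radial: "cos x * Px + sin x * Py = 0" using zero by simp
    have cs: "cos x * cos x + sin x * sin x = 1"
      using sin_cos_squared_add2[of x] by (simp add: power2_eq_square)
    have "Px = (cos x * cos x + sin x * sin x) * Px" by (simp only: cs mult_1_left)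
    also have "\<dots> = cos x * (cos x * Px + sin x * Py) - sin x * (Py * cos x - Px * sin x)"
      by (simp add: algebra_simps del: sin_cos_squared_add3)
    finally have "Px = 0" using radial tangential by simp
    have "Py = (cos x * cos x + sin x * sin x) * Py" by (simp only: cs mult_1_left)
    also have "\<dots> = sin x * (cos x * Px + sin x * Py) + cos x * (Py * cos x - Px * sin x)"
      by (simp add: algebra_simps del: sin_cos_squared_add3)
    finally have "Py = 0" using radial tangential by simp
    have "cos x \<noteq> 0 \<or> sin x \<noteq> 0" using sin_zero_abs_cos_one[of x] by auto
    from form_discriminant_eq_0_if_singular[OF n this] \<open>Px = 0\<close> \<open>Py = 0\<close> disc
    show False unfolding Px_def Py_def by simp
  qed
  then show thesis using that deriv by blast
qed

text \<open>If \<open>x\<close> is not a zero, then the estimate holds because \<open>|sin|\<close> is at most \<open>1\<close>.\<close>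
lemma sin_le_on_circle_local:
  assumes n: "2 \<le> n" and disc: "form_discriminant n c \<noteq> 0"
  shows "\<exists>\<delta> C. 0 < \<delta> \<and> 0 < C \<and> (\<forall>y. \<bar>y - x\<bar> < \<delta> \<longrightarrow> \<bar>sin (y - x)\<bar> \<le> C * \<bar>on_circle n c y\<bar>)"
proof (cases "on_circle n c x = 0")
  case True
  obtain d where d: "(on_circle n c has_real_derivative d) (at x)" "d \<noteq> 0"
    using on_circle_simple_zeros[OF n disc True] .
  have "(\<lambda>y. \<bar>(on_circle n c y - on_circle n c x) / (y - x)\<bar>) \<midarrow>x\<rightarrow> \<bar>d\<bar>"
    using d(1) unfolding has_field_derivative_iff by (rule tendsto_rabs)
  then have "\<forall>\<^sub>F y in at x. \<bar>d\<bar> / 2 < \<bar>(on_circle n c y - on_circle n c x) / (y - x)\<bar>"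
    using d(2) by (intro order_tendstoD(1)) auto
  then obtain \<delta> where \<delta>: "\<delta> > 0"
    "\<And>y. y \<noteq> x \<Longrightarrow> dist y x < \<delta> \<Longrightarrow> \<bar>d\<bar> / 2 < \<bar>on_circle n c y / (y - x)\<bar>"
    unfolding eventually_at True by auto
  have "\<bar>sin (y - x)\<bar> \<le> 2 / \<bar>d\<bar> * \<bar>on_circle n c y\<bar>" if "\<bar>y - x\<bar> < \<delta>" for y
  proof (cases "y = x")
    case False
    have "\<bar>d\<bar> / 2 < \<bar>on_circle n c y\<bar> / \<bar>y - x\<bar>"
      using \<delta>(2)[OF False] that by (simp add: dist_real_def)
    then have "\<bar>y - x\<bar> \<le> 2 / \<bar>d\<bar> * \<bar>on_circle n c y\<bar>" using False d(2) by (simp add: field_simps)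
    then show ?thesis using abs_sin_x_le_abs_x[of "y - x"] by linarith
  qed simp
  then show ?thesis using \<delta>(1) d(2) by (intro exI[of _ \<delta>] exI[of _ "2 / \<bar>d\<bar>"]) auto
next
  case False
  have "isCont (on_circle n c) x"
    using on_circle_deriv[where n = n and x = x and c = c] n by (intro DERIV_isCont) auto
  then have "(\<lambda>y. \<bar>on_circle n c y\<bar>) \<midarrow>x\<rightarrow> \<bar>on_circle n c x\<bar>"
    unfolding isCont_def by (rule tendsto_rabs)
  then have "\<forall>\<^sub>F y in at x. \<bar>on_circle n c x\<bar> / 2 < \<bar>on_circle n c y\<bar>"
    using False by (intro order_tendstoD(1)) auto
  then obtain \<delta> where \<delta>: "\<delta> > 0"
    "\<And>y. y \<noteq> x \<Longrightarrow> dist y x < \<delta> \<Longrightarrow> \<bar>on_circle n c x\<bar> / 2 < \<bar>on_circle n c y\<bar>"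
    unfolding eventually_at by auto
  have "\<bar>sin (y - x)\<bar> \<le> 2 / \<bar>on_circle n c x\<bar> * \<bar>on_circle n c y\<bar>" if "\<bar>y - x\<bar> < \<delta>" for y
  proof -
    have "\<bar>on_circle n c x\<bar> / 2 < \<bar>on_circle n c y\<bar>"
      using \<delta>(2)[of y] that False by (cases "y = x") (auto simp: dist_real_def)
    then have "1 \<le> 2 / \<bar>on_circle n c x\<bar> * \<bar>on_circle n c y\<bar>" using False by (simp add: field_simps)
    then show ?thesis using abs_sin_le_one[of "y - x"] by linarith
  qed
  then show ?thesis using \<delta>(1) False
    by (intro exI[of _ \<delta>] exI[of _ "2 / \<bar>on_circle n c x\<bar>"]) auto
qed

lemma sin_le_on_circle:
  assumes n: "2 \<le> n" and disc: "form_discriminant n c \<noteq> 0"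
  shows "\<exists>\<Theta> C. finite \<Theta> \<and> 0 < C \<and> (\<forall>x. \<exists>\<tau>\<in>\<Theta>. \<bar>sin (x - \<tau>)\<bar> \<le> C * \<bar>on_circle n c x\<bar>)"
proof -
  obtain \<delta> C where \<delta>: "\<And>x. 0 < \<delta> x" and C: "\<And>x. 0 < C x"
    and near: "\<And>x y. \<bar>y - x\<bar> < \<delta> x \<Longrightarrow> \<bar>sin (y - x)\<bar> \<le> C x * \<bar>on_circle n c y\<bar>"
    using sin_le_on_circle_local[OF n disc] by metis
  have "{0..pi} \<subseteq> (\<Union>x\<in>{0..pi}. ball x (\<delta> x))" using \<delta> by auto
  then obtain \<Theta> where \<Theta>: "\<Theta> \<subseteq> {0..pi}" "finite \<Theta>" "{0..pi} \<subseteq> (\<Union>x\<in>\<Theta>. ball x (\<delta> x))"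
    by (rule compactE_image[OF compact_Icc, rotated]) auto
  have "\<exists>\<tau>\<in>\<Theta>. \<bar>sin (x - \<tau>)\<bar> \<le> (1 + sum C \<Theta>) * \<bar>on_circle n c x\<bar>" for x
  proof -
    define d where "d = - (of_int \<lfloor>x / pi\<rfloor> * pi)"
    have "sin (of_int \<lfloor>x / pi\<rfloor> * pi) = 0" unfolding sin_zero_iff_int2 by blast
    then have d: "sin d = 0" by (simp add: d_def)
    have "x + d \<in> {0..pi}"
    proof -
      have "of_int \<lfloor>x / pi\<rfloor> \<le> x / pi" "x / pi < of_int \<lfloor>x / pi\<rfloor> + 1" by linarith+
      then have "of_int \<lfloor>x / pi\<rfloor> * pi \<le> x" "x < (of_int \<lfloor>x / pi\<rfloor> + 1) * pi"
        using pi_gt_zero by (simp_all only: pos_le_divide_eq pos_divide_less_eq)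
      then show ?thesis by (simp add: d_def algebra_simps)
    qed
    then obtain \<tau> where \<tau>: "\<tau> \<in> \<Theta>" "\<bar>x + d - \<tau>\<bar> < \<delta> \<tau>"
      using \<Theta>(3) by (auto simp: dist_real_def abs_minus_commute)
    have "\<bar>sin (x - \<tau>)\<bar> = \<bar>sin (x + d - \<tau>)\<bar>"
      using abs_sin_add_of_sin_eq_0[OF d, of "x - \<tau>"] by (simp add: algebra_simps)
    also have "\<dots> \<le> C \<tau> * \<bar>on_circle n c (x + d)\<bar>" using near[OF \<tau>(2)] .
    also have "\<dots> = C \<tau> * \<bar>on_circle n c x\<bar>" using on_circle_shift[OF d] by simp
    also have "\<dots> \<le> (1 + sum C \<Theta>) * \<bar>on_circle n c x\<bar>"
      using member_le_sum[OF \<tau>(1), of C] \<Theta>(2) C by (intro mult_right_mono) (auto simp: less_imp_le add.commute add_increasing2)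
    finally show ?thesis using \<tau>(1) by blast
  qed
  moreover have "0 < 1 + sum C \<Theta>" using C by (intro add_pos_nonneg sum_nonneg) (auto intro: less_imp_le)
  ultimately show ?thesis using \<Theta>(2) by blast
qed

lemma circle_function_on_circle:
  assumes "3 \<le> n" and "form_discriminant n c \<noteq> 0"
  shows "\<exists>\<Theta> C B. circle_function n (on_circle n c) \<Theta> C B"
proof -
  obtain \<Theta> C where "finite \<Theta>" "0 < C" "\<And>x. \<exists>\<tau>\<in>\<Theta>. \<bar>sin (x - \<tau>)\<bar> \<le> C * \<bar>on_circle n c x\<bar>"
    using sin_le_on_circle[of n c] assms by auto
  moreover obtain B where "0 < B" "\<And>x y. \<bar>on_circle n c x - on_circle n c y\<bar> \<le> B * \<bar>x - y\<bar>"
    using on_circle_lipschitz[of n c] by blast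
  ultimately have "circle_function n (on_circle n c) \<Theta> C B"
    using assms(1) on_circle_shift by unfold_locales auto
  then show ?thesis by blast
qed

section \<open>Minima of a binary form on unimodular lattices\<close>

lemma binary_form_eq: "binary_form n c v = (\<Sum>i\<le>n. c i * fst v ^ i * snd v ^ (n - i))"
  by (simp add: binary_form_def case_prod_beta)

lemma tendsto_binary_form:
  assumes "(f \<longlongrightarrow> v) F"
  shows "((\<lambda>x. binary_form n c (f x)) \<longlongrightarrow> binary_form n c v) F"
  unfolding binary_form_eq using assms by (intro tendsto_intros)

lemma binary_form_bound: "\<exists>G\<ge>0. \<forall>v. \<bar>binary_form n c v\<bar> \<le> G * norm v ^ n"
proof (intro exI conjI allI)
  show "0 \<le> (\<Sum>i\<le>n. \<bar>c i\<bar>)" by (simp add: sum_nonneg)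
  fix v :: "real \<times> real"
  have f: "\<bar>fst v\<bar> \<le> norm v" and s: "\<bar>snd v\<bar> \<le> norm v"
    using norm_fst_le[of "fst v" "snd v"] norm_snd_le[of "snd v" "fst v"] by simp_all
  have "\<bar>fst v ^ i * snd v ^ (n - i)\<bar> \<le> norm v ^ n" if "i \<le> n" for i
  proof -
    have "\<bar>fst v\<bar> ^ i * \<bar>snd v\<bar> ^ (n - i) \<le> norm v ^ i * norm v ^ (n - i)"
      using f s by (intro mult_mono power_mono) auto
    then show ?thesis using that by (simp add: abs_mult power_abs flip: power_add)
  qed
  then have "\<bar>c i * fst v ^ i * snd v ^ (n - i)\<bar> \<le> \<bar>c i\<bar> * norm v ^ n" if "i \<le> n" for i
    using that by (simp add: abs_mult mult.assoc mult_left_mono)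
  then show "\<bar>binary_form n c v\<bar> \<le> (\<Sum>i\<le>n. \<bar>c i\<bar>) * norm v ^ n"
    unfolding binary_form_eq sum_distrib_right
    by (intro order_trans[OF sum_abs] sum_mono) auto
qed

lemma unimodular_lattice_iff:
  "unimodular_lattice L \<longleftrightarrow> (\<exists>u w. lattice_basis u w L \<and> \<bar>det2 u w\<bar> = 1)"
  unfolding unimodular_lattice_def is_lattice_def using covolume_eq by metis

lemma lattice_basis_det_ge_1:
  assumes "lattice_basis u w L" "\<bar>det2 u w\<bar> = 1" "v \<in> L" "v' \<in> L" "det2 v v' \<noteq> 0"
  shows "1 \<le> \<bar>det2 v v'\<bar>"
proof -
  obtain a b a' b' :: int where "v = of_int a *\<^sub>R u + of_int b *\<^sub>R w" "v' = of_int a' *\<^sub>R u + of_int b' *\<^sub>R w"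
    using assms(1,3,4) unfolding lattice_basis_def by blast
  then have e: "det2 v v' = of_int (a * b' - b * a') * det2 u w" by (simp add: det2_int_comb)
  then have "a * b' - b * a' \<noteq> 0" using assms(5) by (metis mult_eq_0_iff of_int_0)
  then have "1 \<le> \<bar>a * b' - b * a'\<bar>" by linarith
  then have "(1::real) \<le> \<bar>of_int (a * b' - b * a')\<bar>" by linarith
  then show ?thesis unfolding e abs_mult assms(2) by simp
qed

lemma lattice_basis_change:
  assumes "lattice_basis u w L"
  shows "lattice_basis w u L" "lattice_basis u (w - of_int k *\<^sub>R u) L"
proof -
  have d: "det2 u w \<noteq> 0" and L: "L = {of_int a *\<^sub>R u + of_int b *\<^sub>R w | a b :: int. True}"
    using assms by (auto simp: lattice_basis_def)
  have "L = {of_int a *\<^sub>R w + of_int b *\<^sub>R u | a b :: int. True}"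
    unfolding L by (auto simp: add.commute) (metis add.commute)+
  then show "lattice_basis w u L" using d by (auto simp: lattice_basis_def det2_def algebra_simps)
  have "of_int a *\<^sub>R u + of_int b *\<^sub>R w =
      of_int (a + b * k) *\<^sub>R u + of_int b *\<^sub>R (w - of_int k *\<^sub>R u)" for a b :: int
    by (simp add: algebra_simps)
  moreover have "of_int a *\<^sub>R u + of_int b *\<^sub>R (w - of_int k *\<^sub>R u) =
      of_int (a - b * k) *\<^sub>R u + of_int b *\<^sub>R w" for a b :: int
    by (simp add: algebra_simps)
  ultimately have "L = {of_int a *\<^sub>R u + of_int b *\<^sub>R (w - of_int k *\<^sub>R u) | a b :: int. True}"
    unfolding L by (intro Collect_cong) metis
  moreover have "det2 u (w - of_int k *\<^sub>R u) = det2 u w" by (simp add: det2_def algebra_simps)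
  ultimately show "lattice_basis u (w - of_int k *\<^sub>R u) L" using d by (auto simp: lattice_basis_def)
qed

lemma lattice_basis_mem: "lattice_basis u w L \<Longrightarrow> of_int a *\<^sub>R u + of_int b *\<^sub>R w \<in> L"
  unfolding lattice_basis_def by blast

lemma lattice_basis_nonzero:
  assumes "det2 u w \<noteq> 0" "a *\<^sub>R u + b *\<^sub>R w = 0"
  shows "a = 0 \<and> b = 0"
proof -
  have "a * det2 u w = det2 (a *\<^sub>R u + b *\<^sub>R w) w" "b * det2 u w = det2 u (a *\<^sub>R u + b *\<^sub>R w)"
    by (simp_all add: det2_def algebra_simps)
  then show ?thesis using assms by (simp_all add: det2_def zero_prod_def)
qed

lemma lattice_basis_first:
  assumes "lattice_basis u w L"
  shows "u \<in> L - {0}"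
proof -
  have "u \<in> L" using lattice_basis_mem[OF assms, of 1 0] by simp
  moreover have "u \<noteq> 0" using assms by (auto simp: lattice_basis_def det2_def)
  ultimately show ?thesis by simp
qed

lemma inner_det2: "(inner u w)\<^sup>2 + (det2 u w)\<^sup>2 = (norm u)\<^sup>2 * (norm w)\<^sup>2" for u w :: "real \<times> real"
  unfolding power2_norm_eq_inner by (simp add: inner_prod_def det2_def power2_eq_square algebra_simps)

text \<open>Reduction of a basis.  Instead of a shortest vector, whose existence would need discreteness,
  the first basis vector is chosen within a factor \<open>11 / 10\<close> of the infimum of its possible
  lengths; this still gives \<open>norm u \<le> 2\<close>.\<close>
lemma bounded_basis:
  assumes L: "unimodular_lattice L" and d: "0 < d" "\<And>v. v \<in> L - {0} \<Longrightarrow> d \<le> norm v"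
  shows "\<exists>u w. lattice_basis u w L \<and> \<bar>det2 u w\<bar> = 1 \<and> norm u \<le> 2 \<and> norm w \<le> 1 + 1 / d"
proof -
  define S where "S = {norm u | u w. lattice_basis u w L}"
  have S: "S \<noteq> {}" using L by (auto simp: S_def unimodular_lattice_def is_lattice_def)
  have lb: "d \<le> x" if "x \<in> S" for x
    using that d(2) lattice_basis_first by (auto simp: S_def)
  have bdd: "bdd_below S" using lb by (rule bdd_belowI)
  have m: "d \<le> Inf S" using S lb by (rule cInf_greatest)
  have "Inf S < 11 / 10 * Inf S" using m d by simp
  then obtain x where "x \<in> S" "x < 11 / 10 * Inf S" using cInf_lessD[OF S] by blast
  then obtain u w0 where u: "lattice_basis u w0 L" "norm u < 11 / 10 * Inf S" by (auto simp: S_def)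
  have nu: "d \<le> norm u" using d(2) lattice_basis_first[OF u(1)] by blast
  define k where "k = round (inner u w0 / (norm u)\<^sup>2)"
  define w where "w = w0 - of_int k *\<^sub>R u"
  have w: "lattice_basis u w L" unfolding w_def by (rule lattice_basis_change(2)[OF u(1)])
  have det: "\<bar>det2 u w\<bar> = 1"
    using covolume_eq[OF w] L by (simp add: unimodular_lattice_def)
  have "\<bar>inner u w0 / (norm u)\<^sup>2 - of_int k\<bar> \<le> 1 / 2"
    unfolding k_def using of_int_round_abs_le[of "inner u w0 / (norm u)\<^sup>2"] by linarith
  then have "\<bar>inner u w0 / (norm u)\<^sup>2 - of_int k\<bar> * (norm u)\<^sup>2 \<le> 1 / 2 * (norm u)\<^sup>2"
    by (rule mult_right_mono) simp
  moreover have "inner u w = (inner u w0 / (norm u)\<^sup>2 - of_int k) * (norm u)\<^sup>2"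
  proof -
    have "inner u w = inner u w0 - of_int k * (norm u)\<^sup>2"
      by (simp add: w_def inner_diff_right power2_norm_eq_inner)
    then show ?thesis using nu d by (simp add: left_diff_distrib)
  qed
  ultimately have iuw: "\<bar>inner u w\<bar> \<le> (norm u)\<^sup>2 / 2" by (simp add: abs_mult)
  define x y where "x = (norm u)\<^sup>2" and "y = (norm w)\<^sup>2"
  have x: "d\<^sup>2 \<le> x" "0 < x" using nu d by (auto simp: x_def intro!: power_mono)
  have "(inner u w)\<^sup>2 \<le> (x / 2)\<^sup>2"
    using iuw unfolding x_def by (intro abs_le_square_iff[THEN iffD1]) auto
  moreover have "(inner u w)\<^sup>2 + 1 = x * y"
  proof -
    have "(det2 u w)\<^sup>2 = 1" using det power2_abs[of "det2 u w"] by simp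
    then show ?thesis using inner_det2[of u w] by (simp add: x_def y_def)
  qed
  ultimately have xy: "x * y \<le> x\<^sup>2 / 4 + 1" by (simp add: power_divide)
  have "Inf S \<le> norm w"
  proof (rule cInf_lower[OF _ bdd])
    show "norm w \<in> S" unfolding S_def using lattice_basis_change(1)[OF w] by blast
  qed
  then have "norm u \<le> 11 / 10 * norm w" using u(2) by linarith
  then have "(norm u)\<^sup>2 \<le> (11 / 10 * norm w)\<^sup>2" by (rule power_mono) simp
  then have "x \<le> 121 / 100 * y" by (simp add: x_def y_def power_mult_distrib power_divide)
  then have "x * x \<le> x * (121 / 100 * y)" using x by (intro mult_left_mono) auto
  then have "x\<^sup>2 \<le> 121 / 100 * (x\<^sup>2 / 4 + 1)" using xy by (simp add: power2_eq_square)
  then have "x\<^sup>2 \<le> 4\<^sup>2" by simp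
  then have x4: "x \<le> 4" by (rule power2_le_imp_le) simp
  have "(norm u)\<^sup>2 \<le> 2\<^sup>2" using x4 by (simp add: x_def)
  then have nu2: "norm u \<le> 2" by (rule power2_le_imp_le) simp
  have "y \<le> x / 4 + 1 / x" using xy x by (simp add: field_simps power2_eq_square)
  also have "\<dots> \<le> 1 + 1 / d\<^sup>2" using x4 x d by (intro add_mono divide_left_mono) auto
  also have "\<dots> \<le> (1 + 1 / d)\<^sup>2" using d by (simp add: power2_sum power_divide)
  finally have "norm w \<le> 1 + 1 / d" unfolding y_def by (rule power2_le_imp_le) (use d in simp)
  then show ?thesis using w det nu2 by blast
qed

text \<open>The infimum of \<open>|P|\<close> over the non-zero vectors of \<open>L\<close>, where \<open>P\<close> is the binary form with
  coefficients \<open>c\<close>.\<close>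
definition form_min :: "nat \<Rightarrow> (nat \<Rightarrow> real) \<Rightarrow> (real \<times> real) set \<Rightarrow> real" where
  "form_min n c L = (INF v \<in> L - {0}. \<bar>binary_form n c v\<bar>)"

lemma lattice_nonempty: "unimodular_lattice L \<Longrightarrow> L - {0} \<noteq> {}"
  unfolding unimodular_lattice_def is_lattice_def using lattice_basis_first by blast

lemma le_form_min_iff:
  "unimodular_lattice L \<Longrightarrow> t \<le> form_min n c L \<longleftrightarrow> (\<forall>v\<in>L - {0}. t \<le> \<bar>binary_form n c v\<bar>)"
  unfolding form_min_def using lattice_nonempty by (intro le_cINF_iff bdd_belowI2[of _ 0]) auto

lemma form_min_le:
  "unimodular_lattice L \<Longrightarrow> v \<in> L - {0} \<Longrightarrow> form_min n c L \<le> \<bar>binary_form n c v\<bar>"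
  using le_form_min_iff by blast

lemma form_min_nonneg: "unimodular_lattice L \<Longrightarrow> 0 \<le> form_min n c L"
  by (simp add: le_form_min_iff)

lemma Spec_eq: "Spec (binary_form n c) = {form_min n c L | L. unimodular_lattice L}"
  by (simp add: Spec_def form_min_def)

lemma bounded_basis_if_form_min_ge:
  assumes n: "1 \<le> n" and t: "0 < t"
  shows "\<exists>R. \<forall>L. unimodular_lattice L \<longrightarrow> t \<le> form_min n c L \<longrightarrow>
    (\<exists>u w. lattice_basis u w L \<and> \<bar>det2 u w\<bar> = 1 \<and> norm u \<le> 2 \<and> norm w \<le> R)"
proof -
  obtain G where G: "0 \<le> G" "\<And>v. \<bar>binary_form n c v\<bar> \<le> G * norm v ^ n"
    using binary_form_bound by blast
  define d where "d = min 1 (t / (G + 1))"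
  have d: "0 < d" "d \<le> 1" "(G + 1) * d \<le> t"
  proof -
    have "d \<le> t / (G + 1)" by (simp add: d_def)
    then show "(G + 1) * d \<le> t" using G(1) by (simp add: field_simps)
  qed (use G t in \<open>auto simp: d_def\<close>)
  have "d \<le> norm v" if L: "unimodular_lattice L" "t \<le> form_min n c L" and v: "v \<in> L - {0}" for L v
  proof (rule ccontr)
    assume "\<not> d \<le> norm v"
    then have "norm v < d" by simp
    moreover have "norm v ^ n \<le> norm v ^ 1"
      using \<open>norm v < d\<close> d n by (intro power_decreasing) auto
    ultimately have "norm v ^ n < d" by simp
    then have "G * norm v ^ n \<le> G * d" using G by (intro mult_left_mono) auto
    moreover have "t \<le> \<bar>binary_form n c v\<bar>" using form_min_le[OF L(1) v, of n c] L(2) by linarith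
    ultimately show False using G(2)[of v] d by (simp add: distrib_right)
  qed
  then show ?thesis using bounded_basis[OF _ d(1)] by blast
qed

lemma form_min_attains_max:
  assumes n: "1 \<le> n" and L0: "unimodular_lattice L0" "0 < form_min n c L0"
  shows "\<exists>L. unimodular_lattice L \<and> (\<forall>L'. unimodular_lattice L' \<longrightarrow> form_min n c L' \<le> form_min n c L)"
proof -
  let ?S = "{form_min n c L | L. unimodular_lattice L}"
  obtain G where G: "0 \<le> G" "\<And>v. \<bar>binary_form n c v\<bar> \<le> G * norm v ^ n"
    using binary_form_bound by blast
  have le: "form_min n c L \<le> G * 2 ^ n" if L: "unimodular_lattice L" for L
  proof (cases "0 < form_min n c L")
    case True
    obtain u w where u: "lattice_basis u w L" "norm u \<le> 2"
      using bounded_basis_if_form_min_ge[OF n True, of c] L by blast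
    have "form_min n c L \<le> \<bar>binary_form n c u\<bar>"
      using form_min_le[OF L lattice_basis_first[OF u(1)]] .
    also have "\<dots> \<le> G * norm u ^ n" by (rule G)
    also have "\<dots> \<le> G * 2 ^ n" using u(2) G(1) by (intro mult_left_mono power_mono) auto
    finally show ?thesis .
  next
    case False
    moreover have "0 \<le> G * 2 ^ n" using G(1) by simp
    ultimately show ?thesis by linarith
  qed
  have bdd: "bdd_above ?S" using le by (intro bdd_aboveI[of _ "G * 2 ^ n"]) auto
  define M where "M = Sup ?S"
  have upper: "form_min n c L \<le> M" if "unimodular_lattice L" for L
    unfolding M_def using that bdd by (intro cSup_upper) auto
  have M: "0 < M" using upper[OF L0(1)] L0(2) by linarith
  have "\<exists>L. unimodular_lattice L \<and> M - M / (real k + 2) < form_min n c L" for k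
  proof -
    have "M - M / (real k + 2) < Sup ?S" using M by (simp add: M_def)
    then obtain x where "x \<in> ?S" "M - M / (real k + 2) < x" using less_cSupD[of ?S] L0(1) by blast
    then show ?thesis by blast
  qed
  then obtain L where L: "\<And>k. unimodular_lattice (L k)"
      "\<And>k. M - M / (real k + 2) < form_min n c (L k)" by metis
  have half: "M / 2 \<le> form_min n c (L k)" for k
  proof -
    have "M / (real k + 2) \<le> M / 2" using M by (intro divide_left_mono) auto
    then show ?thesis using L(2)[of k] by linarith
  qed
  obtain R where R: "\<And>L. unimodular_lattice L \<Longrightarrow> M / 2 \<le> form_min n c L \<Longrightarrow>
    (\<exists>u w. lattice_basis u w L \<and> \<bar>det2 u w\<bar> = 1 \<and> norm u \<le> 2 \<and> norm w \<le> R)"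
    using bounded_basis_if_form_min_ge[OF n, of "M / 2" c] M by auto
  obtain u w where uw: "\<And>k. lattice_basis (u k) (w k) (L k)" "\<And>k. \<bar>det2 (u k) (w k)\<bar> = 1"
      "\<And>k. norm (u k) \<le> 2" "\<And>k. norm (w k) \<le> R"
    using R[OF L(1) half] by metis
  have cpt: "seq_compact (cball (0 :: real \<times> real) 2 \<times> cball (0 :: real \<times> real) R)"
    by (intro compact_imp_seq_compact compact_Times compact_cball)
  have mem: "\<forall>k. (u k, w k) \<in> cball 0 2 \<times> cball 0 R" using uw(3,4) by simp
  obtain l r where "l \<in> cball 0 2 \<times> cball 0 R" and
      lr: "strict_mono (r :: nat \<Rightarrow> nat)" "((\<lambda>k. (u k, w k)) \<circ> r) \<longlonglongrightarrow> l"
    by (rule seq_compactE[OF cpt mem])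
  obtain u' w' where l: "l = (u', w')" by (cases l)
  have lim: "(\<lambda>k. u (r k)) \<longlonglongrightarrow> u'" "(\<lambda>k. w (r k)) \<longlonglongrightarrow> w'"
    using tendsto_fst[OF lr(2)] tendsto_snd[OF lr(2)] by (simp_all add: l o_def)
  have "(\<lambda>k. \<bar>det2 (u (r k)) (w (r k))\<bar>) \<longlonglongrightarrow> \<bar>det2 u' w'\<bar>"
    unfolding det2_def using lim by (intro tendsto_intros)
  then have det: "\<bar>det2 u' w'\<bar> = 1" unfolding uw(2) by (simp add: LIMSEQ_const_iff)
  define L' where "L' = {of_int a *\<^sub>R u' + of_int b *\<^sub>R w' | a b :: int. True}"
  have L': "lattice_basis u' w' L'" using det by (auto simp: lattice_basis_def L'_def)
  have uL': "unimodular_lattice L'" using L' det unimodular_lattice_iff by blast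
  have "M \<le> \<bar>binary_form n c v\<bar>" if v: "v \<in> L' - {0}" for v
  proof -
    obtain a b :: int where ab: "v = of_int a *\<^sub>R u' + of_int b *\<^sub>R w'" using v by (auto simp: L'_def)
    let ?v = "\<lambda>k. of_int a *\<^sub>R u (r k) + of_int b *\<^sub>R w (r k)"
    have "(\<lambda>k. \<bar>binary_form n c (?v k)\<bar>) \<longlonglongrightarrow> \<bar>binary_form n c v\<bar>"
      unfolding ab using lim by (intro tendsto_binary_form tendsto_intros)
    moreover have "(\<lambda>k. M - M / (real (r k) + 2)) \<longlonglongrightarrow> M"
    proof -
      have "(\<lambda>k. M - M / (real k + 2)) \<longlonglongrightarrow> M" by real_asymp
      from LIMSEQ_subseq_LIMSEQ[OF this lr(1)] show ?thesis by (simp add: o_def)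
    qed
    moreover have "M - M / (real (r k) + 2) \<le> \<bar>binary_form n c (?v k)\<bar>" for k
    proof -
      have "?v k \<noteq> 0"
      proof
        assume "?v k = 0"
        then have "real_of_int a = 0 \<and> real_of_int b = 0"
          using uw(2)[of "r k"] by (intro lattice_basis_nonzero[of "u (r k)" "w (r k)"]) auto
        then show False using v ab by simp
      qed
      then have "?v k \<in> L (r k) - {0}" using lattice_basis_mem[OF uw(1)] by blast
      from form_min_le[OF L(1) this, of n c] L(2)[of "r k"] show ?thesis by linarith
    qed
    ultimately show ?thesis by (intro LIMSEQ_le) auto
  qed
  then have "M \<le> form_min n c L'" using le_form_min_iff[OF uL'] by blast
  then show ?thesis using uL' upper by (intro exI[of _ L']) force
qed

section \<open>Rotating a lattice\<close>

text \<open>The rotation by the angle \<open>s\<close>.\<close>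
definition rot :: "real \<Rightarrow> real \<times> real \<Rightarrow> real \<times> real" where
  "rot s v = (fst v * cos s - snd v * sin s, fst v * sin s + snd v * cos s)"

lemma rot_polar: "rot s (r * cos \<phi>, r * sin \<phi>) = (r * cos (\<phi> + s), r * sin (\<phi> + s))"
  by (simp add: rot_def cos_add sin_add algebra_simps)

lemma rot_0 [simp]: "rot 0 v = v"
  by (simp add: rot_def)

lemma rot_linear: "rot s (a *\<^sub>R u + b *\<^sub>R w) = a *\<^sub>R rot s u + b *\<^sub>R rot s w"
  by (simp add: rot_def algebra_simps)

lemma det2_rot: "det2 (rot s u) (rot s w) = det2 u w"
proof -
  have "det2 (rot s u) (rot s w) = ((sin s)\<^sup>2 + (cos s)\<^sup>2) * det2 u w"
    by (simp add: det2_def rot_def power2_eq_square algebra_simps del: sin_cos_squared_add3)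
  then show ?thesis by simp
qed

lemma unimodular_lattice_rot:
  assumes "unimodular_lattice L"
  shows "unimodular_lattice (rot s ` L)"
proof -
  obtain u w where uw: "lattice_basis u w L" "\<bar>det2 u w\<bar> = 1"
    using assms unimodular_lattice_iff by blast
  have "rot s ` L = {of_int a *\<^sub>R rot s u + of_int b *\<^sub>R rot s w | a b :: int. True}"
  proof -
    have "L = {of_int a *\<^sub>R u + of_int b *\<^sub>R w | a b :: int. True}"
      using uw(1) by (simp add: lattice_basis_def)
    then have "rot s ` L = {rot s (of_int a *\<^sub>R u + of_int b *\<^sub>R w) | a b :: int. True}" by blast
    then show ?thesis by (simp only: rot_linear)
  qed
  then have "lattice_basis (rot s u) (rot s w) (rot s ` L)"
    using uw by (simp add: lattice_basis_def det2_rot)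
  then show ?thesis using uw(2) by (metis unimodular_lattice_iff det2_rot)
qed

lemma polar_exists:
  fixes v :: "real \<times> real"
  assumes "v \<noteq> 0"
  obtains r \<phi> where "0 < r" "v = (r * cos \<phi>, r * sin \<phi>)"
proof -
  let ?z = "Complex (fst v) (snd v)"
  have "?z \<noteq> 0" using assms by (simp add: complex_eq_iff prod_eq_iff)
  then have "0 < cmod ?z" by simp
  moreover have "v = (cmod ?z * cos (Arg ?z), cmod ?z * sin (Arg ?z))"
    using rcis_cmod_Arg[of ?z] by (simp add: complex_eq_iff prod_eq_iff)
  ultimately show ?thesis using that by blast
qed

text \<open>All polar coordinates of the non-zero vectors of \<open>L\<close>.  The angle is not normalised: each
  vector occurs with infinitely many angles, differing by multiples of \<open>2 * \<pi>\<close>.\<close>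
definition polar :: "(real \<times> real) set \<Rightarrow> (real \<times> real) set" where
  "polar L = {(r, \<phi>). 0 < r \<and> (r * cos \<phi>, r * sin \<phi>) \<in> L}"

lemma polar_nonzero:
  fixes r \<phi> :: real
  assumes "0 < r"
  shows "(r * cos \<phi>, r * sin \<phi>) \<noteq> 0"
proof
  assume "(r * cos \<phi>, r * sin \<phi>) = 0"
  then have "r * cos \<phi> = 0" "r * sin \<phi> = 0" by (simp_all add: zero_prod_def)
  then have "cos \<phi> = 0" "sin \<phi> = 0" using assms by (metis less_irrefl mult_eq_0_iff)+
  then show False using sin_cos_squared_add[of \<phi>] by simp
qed

lemma det2_polar:
  "det2 (r * cos \<phi>, r * sin \<phi>) (r' * cos \<phi>', r' * sin \<phi>') = - (r * r' * sin (\<phi> - \<phi>'))"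
  by (simp add: det2_def sin_diff algebra_simps)

lemma separated_polar:
  assumes "unimodular_lattice L"
  shows "separated (polar L)"
proof -
  obtain u w where uw: "lattice_basis u w L" "\<bar>det2 u w\<bar> = 1"
    using assms unimodular_lattice_iff by blast
  have "1 \<le> r * r' * \<bar>sin (\<phi> - \<phi>')\<bar>"
    if "(r, \<phi>) \<in> polar L" "(r', \<phi>') \<in> polar L" "sin (\<phi> - \<phi>') \<noteq> 0" for r \<phi> r' \<phi>'
  proof -
    let ?v = "(r * cos \<phi>, r * sin \<phi>)" and ?v' = "(r' * cos \<phi>', r' * sin \<phi>')"
    have r: "0 < r" "0 < r'" "?v \<in> L" "?v' \<in> L" using that by (auto simp: polar_def)
    have "1 \<le> \<bar>det2 ?v ?v'\<bar>"
      using that(3) r by (intro lattice_basis_det_ge_1[OF uw]) (auto simp: det2_polar)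
    then show ?thesis using r by (simp add: det2_polar abs_mult)
  qed
  then show ?thesis by (auto simp: separated_def) (auto simp: polar_def)
qed

lemma le_form_min_rot_iff:
  assumes L: "unimodular_lattice L"
  shows "t \<le> form_min n c (rot s ` L) \<longleftrightarrow>
    (\<forall>(r, \<phi>)\<in>polar L. t \<le> r ^ n * \<bar>on_circle n c (\<phi> + s)\<bar>)"
proof -
  have eq: "\<bar>binary_form n c (rot s (r * cos \<phi>, r * sin \<phi>))\<bar> = r ^ n * \<bar>on_circle n c (\<phi> + s)\<bar>"
    if "0 < r" for r \<phi>
    using that by (simp add: rot_polar binary_form_polar abs_mult)
  have rot_nz: "rot s (r * cos \<phi>, r * sin \<phi>) \<noteq> 0" if "0 < r" for r \<phi>
    using polar_nonzero[OF that] by (simp add: rot_polar)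
  have rot_z: "rot s 0 = 0" by (simp add: rot_def zero_prod_def)
  show ?thesis
    unfolding le_form_min_iff[OF unimodular_lattice_rot[OF L]]
  proof (intro iffI ballI)
    fix x
    assume *: "\<forall>v\<in>rot s ` L - {0}. t \<le> \<bar>binary_form n c v\<bar>" and x: "x \<in> polar L"
    obtain r \<phi> where x_eq: "x = (r, \<phi>)" by (cases x)
    have r: "0 < r" "(r * cos \<phi>, r * sin \<phi>) \<in> L" using x by (auto simp: polar_def x_eq)
    then have "rot s (r * cos \<phi>, r * sin \<phi>) \<in> rot s ` L - {0}" using rot_nz by blast
    then show "case x of (r, \<phi>) \<Rightarrow> t \<le> r ^ n * \<bar>on_circle n c (\<phi> + s)\<bar>"
      using * eq[OF r(1)] unfolding x_eq by (metis case_prod_conv)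
  next
    fix y
    assume *: "\<forall>(r, \<phi>)\<in>polar L. t \<le> r ^ n * \<bar>on_circle n c (\<phi> + s)\<bar>" and "y \<in> rot s ` L - {0}"
    then obtain v where v: "v \<in> L" "y = rot s v" "y \<noteq> 0" by blast
    then have "v \<noteq> 0" using rot_z by metis
    then obtain r \<phi> where r: "0 < r" "v = (r * cos \<phi>, r * sin \<phi>)" by (rule polar_exists)
    then have "(r, \<phi>) \<in> polar L" using v by (simp add: polar_def)
    then have "t \<le> r ^ n * \<bar>on_circle n c (\<phi> + s)\<bar>" using * by blast
    then show "t \<le> \<bar>binary_form n c y\<bar>" unfolding v(2) r(2) eq[OF r(1)] .
  qed
qed

lemma avoids_iff_le_form_min_rot:
  assumes "circle_function n (on_circle n c) \<Theta> C B" and "unimodular_lattice L"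
  shows "(\<forall>R. circle_function.avoids n (on_circle n c) (polar L) t R s) \<longleftrightarrow> t \<le> form_min n c (rot s ` L)"
  unfolding le_form_min_rot_iff[OF assms(2)] circle_function.avoids_def[OF assms(1)] by fast

lemma exists_form_min_pos:
  assumes circ: "circle_function n (on_circle n c) \<Theta> C B"
  shows "\<exists>L. unimodular_lattice L \<and> 0 < form_min n c L"
proof -
  define Z :: "(real \<times> real) set"
    where "Z = {of_int a *\<^sub>R (1, 0) + of_int b *\<^sub>R (0, 1) | a b :: int. True}"
  have "lattice_basis (1, 0) (0, 1) Z" by (simp add: lattice_basis_def Z_def det2_def)
  then have Z: "unimodular_lattice Z" using unimodular_lattice_iff by (force simp: det2_def)
  have Z_far: "1 \<le> r" if "(r, \<phi>) \<in> polar Z" for r \<phi>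
  proof -
    have r: "0 < r" "(r * cos \<phi>, r * sin \<phi>) \<in> Z" using that by (simp_all add: polar_def)
    then obtain a b :: int
      where "(r * cos \<phi>, r * sin \<phi>) = of_int a *\<^sub>R (1, 0) + of_int b *\<^sub>R (0, 1)"
      unfolding Z_def by blast
    then have ab: "r * cos \<phi> = of_int a" "r * sin \<phi> = of_int b" by simp_all
    have "r\<^sup>2 = r\<^sup>2 * ((cos \<phi>)\<^sup>2 + (sin \<phi>)\<^sup>2)" by simp
    also have "\<dots> = (r * cos \<phi>)\<^sup>2 + (r * sin \<phi>)\<^sup>2"
      by (simp only: power_mult_distrib distrib_left)
    also have "\<dots> = of_int (a\<^sup>2 + b\<^sup>2)" by (simp add: ab)
    finally have eq: "r\<^sup>2 = of_int (a\<^sup>2 + b\<^sup>2)" .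
    have "0 < r\<^sup>2" using r by simp
    then have "1 \<le> a\<^sup>2 + b\<^sup>2" unfolding eq by linarith
    then have "1 \<le> r\<^sup>2" unfolding eq by (simp only: of_int_1_le_iff)
    then show ?thesis using r(1) power2_le_imp_le[of 1 r] by simp
  qed
  have "\<exists>t>0. \<exists>s. \<forall>R. circle_function.avoids n (on_circle n c) (polar Z) t R s"
    by (rule circle_function.exists_avoiding_positive[OF circ separated_polar[OF Z]]) (rule Z_far)
  then obtain t s where "0 < t" "t \<le> form_min n c (rot s ` Z)"
    using avoids_iff_le_form_min_rot[OF circ Z] by blast
  then show ?thesis using unimodular_lattice_rot[OF Z] by (meson less_le_trans)
qed

theorem theorem1p6:
  fixes n :: nat and c :: "nat \<Rightarrow> real"
  assumes "n \<ge> 3"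
    and "isotropic (binary_form n c)"
    and "form_discriminant n c \<noteq> 0"
  shows "\<exists>M > 0. Spec (binary_form n c) = {0..M}"
proof -
  let ?p = "on_circle n c"
  obtain \<Theta> C B where circ: "circle_function n ?p \<Theta> C B"
    using circle_function_on_circle[OF assms(1,3)] by blast
  note avoids_iff = avoids_iff_le_form_min_rot[OF circ]
  have "binary_form n c 0 = 0" using binary_form_scale[of n c 0 0 0] assms(1) by (simp add: zero_prod_def power_0_left)
  then obtain e where e: "e \<noteq> 0" "binary_form n c e = 0"
    using assms(2) unfolding isotropic_def anisotropic_def by blast
  obtain \<rho> \<alpha> where \<rho>: "0 < \<rho>" "e = (\<rho> * cos \<alpha>, \<rho> * sin \<alpha>)" using e(1) by (rule polar_exists)
  have p\<alpha>: "?p \<alpha> = 0" using e(2) \<rho> by (simp add: binary_form_polar)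

  obtain L0 where L0: "unimodular_lattice L0" "0 < form_min n c L0"
    using exists_form_min_pos[OF circ] by blast
  have n1: "1 \<le> n" using assms(1) by simp
  from form_min_attains_max[OF n1 L0] obtain L where L: "unimodular_lattice L"
      "\<And>L'. unimodular_lattice L' \<Longrightarrow> form_min n c L' \<le> form_min n c L" by blast
  define M where "M = form_min n c L"
  have M: "0 < M" using L(2)[OF L0(1)] L0(2) by (simp add: M_def)

  \<comment> \<open>Some rotation of the lattice contains an isotropic vector.\<close>
  obtain r0 \<phi>0 where r0: "(r0, \<phi>0) \<in> polar L"
  proof -
    obtain v where v: "v \<in> L" "v \<noteq> 0" using lattice_nonempty[OF L(1)] by blast
    obtain r \<phi> where "0 < r" "v = (r * cos \<phi>, r * sin \<phi>)" using v(2) by (rule polar_exists)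
    then have "(r, \<phi>) \<in> polar L" using v(1) by (simp add: polar_def)
    then show ?thesis by (rule that)
  qed
  obtain s1 where s1: "0 < s1" "form_min n c (rot s1 ` L) = 0"
  proof -
    obtain k :: nat where "\<bar>\<alpha> - \<phi>0\<bar> / pi < real k" using reals_Archimedean2 by blast
    then have k: "0 < \<alpha> - \<phi>0 + real k * pi" by (simp add: pos_divide_less_eq)
    have "sin (real k * pi) = 0" by simp
    from on_circle_shift[OF this, of n c \<alpha>] have "?p (\<phi>0 + (\<alpha> - \<phi>0 + real k * pi)) = 0"
      using p\<alpha> by simp
    moreover have "form_min n c (rot s ` L) \<le> r0 ^ n * \<bar>?p (\<phi>0 + s)\<bar>" for s
      using le_form_min_rot_iff[OF L(1)] r0 by blast
    ultimately have "form_min n c (rot (\<alpha> - \<phi>0 + real k * pi) ` L) \<le> 0"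
      by (metis abs_zero mult_zero_right)
    with form_min_nonneg[OF unimodular_lattice_rot[OF L(1)]] k show ?thesis
      by (intro that) (auto intro: antisym)
  qed

  have "t \<in> Spec (binary_form n c)" if t: "0 < t" "t < M" for t
  proof -
    define T where "T = {s \<in> {0..s1}. t \<le> form_min n c (rot s ` L)}"
    have T_eq: "T = {0..s1} \<inter> (\<Inter>(r, \<phi>)\<in>polar L. {s. t \<le> r ^ n * \<bar>?p (\<phi> + s)\<bar>})"
      unfolding T_def le_form_min_rot_iff[OF L(1)] by auto
    have "closed T"
    proof -
      have cont_p: "continuous_on UNIV ?p"
        by (intro continuous_at_imp_continuous_on ballI DERIV_isCont[OF on_circle_deriv[OF n1]])
      have cont: "continuous_on UNIV (\<lambda>s. r ^ n * \<bar>?p (\<phi> + s)\<bar>)" for r \<phi>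
      proof -
        have "continuous_on UNIV (\<lambda>s. ?p (\<phi> + s))"
          by (rule continuous_on_compose2[OF cont_p]) (auto intro!: continuous_intros)
        then show ?thesis by (intro continuous_intros)
      qed
      have "closed {s. t \<le> r ^ n * \<bar>?p (\<phi> + s)\<bar>}" for r \<phi>
        by (rule closed_Collect_le[OF continuous_on_const cont])
      then have "closed (case x of (r, \<phi>) \<Rightarrow> {s. t \<le> r ^ n * \<bar>?p (\<phi> + s)\<bar>})" for x
        by (cases x) simp
      then show ?thesis unfolding T_eq
        by (intro closed_Int closed_INT ballI closed_atLeastAtMost)
    qed
    moreover have "0 \<in> T" using t s1 by (simp add: T_def M_def)
    moreover have bdd: "bdd_above T" by (rule bdd_aboveI[of _ s1]) (auto simp: T_def)
    ultimately have sT: "Sup T \<in> T" using closed_contains_Sup by blast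
    \<comment> \<open>If \<open>form_min\<close> exceeded \<open>t\<close> at the last angle \<open>s\<close> of \<open>T\<close>, then \<open>T\<close> would contain
      later angles.\<close>
    define s where "s = Sup T"
    have s: "0 \<le> s" "s \<le> s1" "t \<le> form_min n c (rot s ` L)" using sT by (auto simp: T_def s_def)
    have "s \<noteq> s1" using s(3) s1(2) t by auto
    have "form_min n c (rot s ` L) \<le> t"
    proof (rule ccontr)
      assume "\<not> ?thesis"
      then have gt: "t < form_min n c (rot s ` L)" by simp
      have av: "circle_function.avoids n ?p (polar L) (form_min n c (rot s ` L)) R s" for R
        using avoids_iff[OF L(1)] by blast
      have "\<exists>s'>s. s' \<le> s + (s1 - s) \<and> (\<forall>R. circle_function.avoids n ?p (polar L) t R s')"
        by (rule circle_function.exists_avoiding_after[OF circ separated_polar[OF L(1)] t(1) gt av])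
          (use s(2) \<open>s \<noteq> s1\<close> in simp)
      then obtain s' where s': "s < s'" "s' \<le> s1" "t \<le> form_min n c (rot s' ` L)"
        using avoids_iff[OF L(1)] by auto
      then have "s' \<in> T" using s by (simp add: T_def)
      then have "s' \<le> s" unfolding s_def by (rule cSup_upper[OF _ bdd])
      then show False using s'(1) by simp
    qed
    then have "form_min n c (rot s ` L) = t" using s by simp
    then show ?thesis unfolding Spec_eq using unimodular_lattice_rot[OF L(1)] by blast
  qed
  moreover have "0 \<in> Spec (binary_form n c)"
    unfolding Spec_eq mem_Collect_eq using s1(2)[symmetric] unimodular_lattice_rot[OF L(1)] by blast
  moreover have "M \<in> Spec (binary_form n c)" unfolding Spec_eq M_def using L(1) by blast
  ultimately have "x \<in> Spec (binary_form n c)" if "x \<in> {0..M}" for x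
    using that by (cases "x = 0 \<or> x = M") auto
  moreover have "Spec (binary_form n c) \<subseteq> {0..M}"
    unfolding Spec_eq using L(2) form_min_nonneg by (auto simp: M_def)
  ultimately show ?thesis using M by blast
qed

end
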